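(* Let $n\in\mathbb N$, let $K_1,\dots,K_n$ be singular, strictly concave kernel functions satisfying (PM$_0$), and let $J$ be an $n$-field function satisfying either - $(\infty_+)$: $J(0)=\lim_{t\downarrow0}J(t)=-\infty$, or - $(\infty_-)$: $J(1)=\lim_{t\uparrow1}J(t)=-\infty$. Then $\Phi|_Y:Y\to\mathbb R^n$ is a locally bi-Lipschitz homeomorphism of $Y$ onto $\mathbb R^n$.
   Context: A kernel function is a function $K:(-1,0)\cup(0,1)\to\mathbb R$ that is concave on $(-1,0)$ and concave on $(0,1)$ and satisfies $\lim_{t\downarrow0}K(t)=\lim_{t\uparrow0}K(t)$. It is extended to $[-1,1]$ with values in $[-\infty,\infty)$ by its one-sided limits at $-1,0,1$. It is singular if $K(0)=-\infty$. Strictly concave means strictly concave on each of $(-1,0)$ and $(0,1)$. For $c\ge0$, (PM$_c$) means $K'(t)-K'(t-1)\ge c$ for almost every $t\in(0,1)$. An $n$-field function is a function $J:[0,1]\to[-\infty,\infty)$ that is bounded above and whose set of finite values has total weight strictly greater than $n$. Here the points $0$ and $1$ each have weight $1/2$ and every point of $(0,1)$ has weight $1$. $S=\{\mathbf y\in\mathbb R^n:0<y_1<\dots<y_n<1\}$. $F(\mathbf y,t)=J(t)+\sum_{i=1}^nK_i(t-y_i)$, with the convention $a+(-\infty)=-\infty$. Set $y_0:=0$ and $y_{n+1}:=1$. Let $I_j(\mathbf y)=[y_j,y_{j+1}]$ and $m_j(\mathbf y)=\sup_{t\in I_j(\mathbf y)}F(\mathbf y,t)$. $Y=\{\mathbf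 y\in S:m_j(\mathbf y)\ne-\infty\ \forall j\}$. $\Phi(\mathbf y)=(m_1(\mathbf y)-m_0(\mathbf y),\dots,m_n(\mathbf y)-m_{n-1}(\mathbf y))$. *)

theory Defs
  imports "HOL-Analysis.Analysis"
begin

definition strict_concave_on :: "real set \<Rightarrow> (real \<Rightarrow> real) \<Rightarrow> bool" where
  "strict_concave_on A f \<longleftrightarrow> convex A \<and>
     (\<forall>x\<in>A. \<forall>y\<in>A. x \<noteq> y \<longrightarrow> (\<forall>u. 0 < u \<and> u < 1 \<longrightarrow>
        u * f x + (1 - u) * f y < f (u * x + (1 - u) * y)))"

(* Kernel function: concave on (-1,0) and on (0,1), equal one-sided limits at 0
   (limits taken in the extended reals). Only the values of K on (-1,0) \<union> (0,1) matter. *)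
definition kernel_function :: "(real \<Rightarrow> real) \<Rightarrow> bool" where
  "kernel_function K \<longleftrightarrow> concave_on {-1<..<0} K \<and> concave_on {0<..<1} K \<and>
     (\<exists>L::ereal. ((\<lambda>t. ereal (K t)) \<longlongrightarrow> L) (at_right 0) \<and>
                 ((\<lambda>t. ereal (K t)) \<longlongrightarrow> L) (at_left 0))"

definition strictly_concave_kernel :: "(real \<Rightarrow> real) \<Rightarrow> bool" where
  "strictly_concave_kernel K \<longleftrightarrow> strict_concave_on {-1<..<0} K \<and> strict_concave_on {0<..<1} K"

definition kernel_ext :: "(real \<Rightarrow> real) \<Rightarrow> real \<Rightarrow> ereal" where
  "kernel_ext K t =
     (if t = 0 then Lim (at_right 0) (\<lambda>s. ereal (K s))
      else if t = 1 then Lim (at_left 1) (\<lambda>s. ereal (K s))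
      else if t = -1 then Lim (at_right (-1)) (\<lambda>s. ereal (K s))
      else ereal (K t))"

definition singular_kernel :: "(real \<Rightarrow> real) \<Rightarrow> bool" where
  "singular_kernel K \<longleftrightarrow> kernel_ext K 0 = -\<infinity>"

definition PM :: "real \<Rightarrow> (real \<Rightarrow> real) \<Rightarrow> bool" where
  "PM c K \<longleftrightarrow> (AE t in lborel. t \<in> {0<..<1} \<longrightarrow>
      K differentiable (at t) \<and> K differentiable (at (t - 1)) \<and>
      deriv K t - deriv K (t - 1) \<ge> c)"

definition weight :: "real set \<Rightarrow> ereal" where
  "weight A = (if finite (A \<inter> {0<..<1})
      then ereal (real (card (A \<inter> {0<..<1})) + (if 0 \<in> A then 1/2 else 0) + (if 1 \<in> A then 1/2 else 0))
      else \<infinity>)"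

definition field_function :: "nat \<Rightarrow> (real \<Rightarrow> ereal) \<Rightarrow> bool" where
  "field_function n J \<longleftrightarrow> (\<exists>M::real. \<forall>t\<in>{0..1}. J t \<le> ereal M) \<and>
      weight {t\<in>{0..1}. J t \<noteq> -\<infinity>} > ereal (real n)"

(* Points y = (y_1,...,y_n) are encoded 0-based as y 0, ..., y (n-1), with y i = 0 for i \<ge> n,
   i.e. as elements of topspace (Euclidean_space n). *)
definition simplexS :: "nat \<Rightarrow> (nat \<Rightarrow> real) set" where
  "simplexS n = {y. (\<forall>i\<ge>n. y i = 0) \<and> (\<forall>i<n. 0 < y i \<and> y i < 1) \<and>
                    (\<forall>i j. i < j \<and> j < n \<longrightarrow> y i < y j)}"

(* node n y j = y_j for j = 0..n+1 with y_0 = 0, y_{n+1} = 1 (paper's 1-based indexing) *)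
definition node :: "nat \<Rightarrow> (nat \<Rightarrow> real) \<Rightarrow> nat \<Rightarrow> real" where
  "node n y j = (if j = 0 then 0 else if j \<le> n then y (j - 1) else 1)"

definition Ffun :: "nat \<Rightarrow> (real \<Rightarrow> ereal) \<Rightarrow> (nat \<Rightarrow> real \<Rightarrow> real) \<Rightarrow> (nat \<Rightarrow> real) \<Rightarrow> real \<Rightarrow> ereal" where
  "Ffun n J K y t = J t + (\<Sum>i<n. kernel_ext (K i) (t - y i))"

definition mfun :: "nat \<Rightarrow> (real \<Rightarrow> ereal) \<Rightarrow> (nat \<Rightarrow> real \<Rightarrow> real) \<Rightarrow> (nat \<Rightarrow> real) \<Rightarrow> nat \<Rightarrow> ereal" where
  "mfun n J K y j = (SUP t\<in>{node n y j .. node n y (Suc j)}. Ffun n J K y t)"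

definition Yset :: "nat \<Rightarrow> (real \<Rightarrow> ereal) \<Rightarrow> (nat \<Rightarrow> real \<Rightarrow> real) \<Rightarrow> (nat \<Rightarrow> real) set" where
  "Yset n J K = {y \<in> simplexS n. \<forall>j\<le>n. mfun n J K y j \<noteq> -\<infinity>}"

definition Phi :: "nat \<Rightarrow> (real \<Rightarrow> ereal) \<Rightarrow> (nat \<Rightarrow> real \<Rightarrow> real) \<Rightarrow> (nat \<Rightarrow> real) \<Rightarrow> nat \<Rightarrow> real" where
  "Phi n J K y i = (if i < n then real_of_ereal (mfun n J K y (Suc i) - mfun n J K y i) else 0)"

definition edist :: "nat \<Rightarrow> (nat \<Rightarrow> real) \<Rightarrow> (nat \<Rightarrow> real) \<Rightarrow> real" where
  "edist n x y = L2_set (\<lambda>i. x i - y i) {..<n}"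

definition locally_bilipschitz_on :: "nat \<Rightarrow> (nat \<Rightarrow> real) set \<Rightarrow> ((nat \<Rightarrow> real) \<Rightarrow> (nat \<Rightarrow> real)) \<Rightarrow> bool" where
  "locally_bilipschitz_on n A f \<longleftrightarrow> (\<forall>y\<in>A. \<exists>r>0. \<exists>c>0. \<exists>C.
      \<forall>a\<in>A. \<forall>b\<in>A. edist n a y < r \<and> edist n b y < r \<longrightarrow>
        c * edist n a b \<le> edist n (f a) (f b) \<and> edist n (f a) (f b) \<le> C * edist n a b)"

end

theory Submission
  imports Defs "HOL-Homology.Invariance_of_Domain"
begin

text \<open>
  Let \<open>y, y'\<close> be two node systems and \<open>s\<^sub>i\<close> the sign of \<open>y'\<^sub>i - y\<^sub>i\<close>. Summation by parts turns
  \<open>-\<Sum>\<^sub>i s\<^sub>i (\<Phi>\<^sub>i y' - \<Phi>\<^sub>i y)\<close> into a combination of the differences \<open>m\<^sub>j y' - m\<^sub>j y\<close> over those \<open>j\<close> at which the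
  sign changes. There one of the intervals \<open>I\<^sub>j y\<close>, \<open>I\<^sub>j y'\<close> contains the other, and an almost maximal point
  \<open>t\<^sub>j\<close> of the smaller one bounds the difference in the right direction. Concavity and \<open>(PM\<^sub>0)\<close> show that each
  kernel contributes at least its differences at \<open>t\<^sub>0\<close> and \<open>t\<^sub>n\<close> alone, and since \<open>J\<close> forces \<open>t\<^sub>n - t\<^sub>0\<close> to stay
  below \<open>1\<close>, strict concavity makes this at least \<open>c \<bar>y'\<^sub>i - y\<^sub>i\<bar>\<close>. Hence \<open>\<Phi>\<close> is injective and expands distances,
  uniformly as long as the \<open>m\<^sub>j\<close> are bounded below. Singularity keeps almost maximal points away from the nodes,
  so \<open>Y\<close> is open and the \<open>m\<^sub>j\<close> are locally Lipschitz. The image of \<open>\<Phi>\<close> is open by invariance of domain. It is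
  closed because \<open>max\<^sub>j m\<^sub>j\<close> is bounded below on \<open>S\<close>, so that a bound on \<open>\<Phi>\<close> bounds all \<open>m\<^sub>j\<close> from below.
\<close>

subsection \<open>Concave functions\<close>

text \<open>The two inner points are convex combinations of the outer ones with complementary
  weights \<open>u\<close> and \<open>1 - u\<close>, so the two concavity inequalities add
  up.\<close>

lemma concave_on_four_points:
  fixes f :: "real \<Rightarrow> real"
  assumes "concave_on I f" "p \<in> I" "p + h + d \<in> I" "0 \<le> h" "0 \<le> d"
  shows "f p + f (p + h + d) \<le> f (p + h) + f (p + d)"
proof (cases "h + d = 0")
  case True
  then have "h = 0" "d = 0" using assms by auto
  then show ?thesis by simp
next
  case False
  define u where "u = h / (h + d)"
  have u: "0 \<le> u" "u \<le> 1" "u * (h + d) = h"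
    using False assms by (auto simp: u_def field_simps)
  have "(1 - u) * p + u * (p + h + d) = p + u * (h + d)"
    "(1 - (1 - u)) * p + (1 - u) * (p + h + d) = p + (h + d) - u * (h + d)"
    by (auto simp: algebra_simps)
  with u have *: "(1 - u) * p + u * (p + h + d) = p + h"
     "(1 - (1 - u)) * p + (1 - u) * (p + h + d) = p + d"
    by auto
  have "(1 - u) * f p + u * f (p + h + d) \<le> f (p + h)"
    using concave_onD[OF assms(1), of u p "p + h + d"] u assms * by simp
  moreover have "(1 - (1 - u)) * f p + (1 - u) * f (p + h + d) \<le> f (p + d)"
    using concave_onD[OF assms(1), of "1 - u" p "p + h + d"] u assms *(2) by simp
  ultimately show ?thesis by (simp add: algebra_simps)
qed

lemma concave_on_slopes:
  fixes f :: "real \<Rightarrow> real"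
  assumes "concave_on I f" "x \<in> I" "z \<in> I" "x < y" "y < z"
  shows "(f z - f y) / (z - y) \<le> (f z - f x) / (z - x)"
    and "(f z - f x) / (z - x) \<le> (f y - f x) / (y - x)"
proof -
  have eq: "(- f a - - f b) / (a - b) = - ((f b - f a) / (b - a))" for a b
    by (metis minus_diff_eq minus_diff_minus minus_divide_left minus_divide_right)
  show "(f z - f y) / (z - y) \<le> (f z - f x) / (z - x)"
    "(f z - f x) / (z - x) \<le> (f y - f x) / (y - x)"
    using convex_on_slope_le[OF assms(1)[unfolded concave_on_def] assms(2-5)]
    unfolding eq by auto
qed

lemma concave_on_slopes_disjoint:
  fixes f :: "real \<Rightarrow> real"
  assumes f: "concave_on I f" and "w \<in> I" "z \<in> I" "w < x" "x \<le> y" "y < z"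
  shows "(f z - f y) / (z - y) \<le> (f x - f w) / (x - w)"
proof (cases "x = y")
  case True
  then show ?thesis
    using concave_on_slopes[OF f, of w z x] assms by auto
next
  case False
  have "convex I" using f by (simp add: concave_on_imp_convex)
  moreover have "x \<in> closed_segment w z" using assms by (auto simp: closed_segment_eq_real_ivl)
  ultimately have "x \<in> I" using closed_segment_subset assms by blast
  have "(f z - f y) / (z - y) \<le> (f z - f x) / (z - x)"
    using concave_on_slopes(1)[OF f \<open>x \<in> I\<close> \<open>z \<in> I\<close>, of y] False assms by auto
  also have "\<dots> \<le> (f x - f w) / (x - w)"
    using concave_on_slopes[OF f \<open>w \<in> I\<close> \<open>z \<in> I\<close>, of x] False assms by auto
  finally show ?thesis .
qed

text \<open>Slopes inside \<open>[a,b]\<close> are squeezed between the slope \<open>U\<close> over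
  a margin interval on the left and the slope \<open>V\<close> over one on the right.\<close>

lemma concave_on_imp_lipschitz:
  fixes f :: "real \<Rightarrow> real"
  assumes f: "concave_on {l<..<r} f" and "l < a" "a \<le> b" "b < r"
  obtains L where "0 \<le> L" "\<And>x y. \<lbrakk>x \<in> {a..b}; y \<in> {a..b}\<rbrakk> \<Longrightarrow> \<bar>f x - f y\<bar> \<le> L * \<bar>x - y\<bar>"
proof -
  define a' where "a' = (l + a) / 2"
  define b' where "b' = (b + r) / 2"
  have ab: "l < a'" "a' < a" "b < b'" "b' < r" using assms by (auto simp: a'_def b'_def)
  define U where "U = (f a - f a') / (a - a')"
  define V where "V = (f b' - f b) / (b' - b)"
  have *: "\<bar>f y - f x\<bar> \<le> max \<bar>U\<bar> \<bar>V\<bar> * \<bar>y - x\<bar>" if "x \<in> {a..b}" "y \<in> {a..b}" "x < y" for x y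
  proof -
    define s where "s = (f y - f x) / (y - x)"
    have "s \<le> U" unfolding s_def U_def
      by (rule concave_on_slopes_disjoint[OF f]) (use that ab assms in auto)
    moreover have "V \<le> s" unfolding s_def V_def
      by (rule concave_on_slopes_disjoint[OF f]) (use that ab assms in auto)
    ultimately have "\<bar>s\<bar> \<le> max \<bar>U\<bar> \<bar>V\<bar>" by linarith
    moreover have "f y - f x = s * (y - x)" using that by (simp add: s_def)
    ultimately show ?thesis by (metis abs_ge_zero abs_mult mult_right_mono)
  qed
  show thesis
  proof
    show "0 \<le> max \<bar>U\<bar> \<bar>V\<bar>" by simp
    fix x y assume "x \<in> {a..b}" "y \<in> {a..b}"
    then show "\<bar>f x - f y\<bar> \<le> max \<bar>U\<bar> \<bar>V\<bar> * \<bar>x - y\<bar>"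
      using *[of x y] *[of y x] by (cases x y rule: linorder_cases) (auto simp: abs_minus_commute)
  qed
qed

text \<open>Right of the midpoint \<open>c\<close> the graph lies below the line of slope
  \<open>U\<close> through it, left of \<open>c\<close> below the line of slope \<open>V\<close>,
  and the interval is bounded.\<close>

lemma concave_on_imp_bounded_above:
  fixes f :: "real \<Rightarrow> real"
  assumes f: "concave_on {l<..<r} f" and "l < r"
  obtains M where "\<And>x. x \<in> {l<..<r} \<Longrightarrow> f x \<le> M"
proof -
  define c where "c = (l + r) / 2"
  define w where "w = (l + c) / 2"
  define v where "v = (c + r) / 2"
  have c: "l < w" "w < c" "c < v" "v < r" using \<open>l < r\<close> by (auto simp: c_def w_def v_def)
  define U where "U = (f c - f w) / (c - w)"
  define V where "V = (f v - f c) / (v - c)"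
  have "f x \<le> f c + (\<bar>U\<bar> + \<bar>V\<bar>) * (r - l)" if x: "x \<in> {l<..<r}" for x
  proof (cases x c rule: linorder_cases)
    case greater
    have "(f x - f c) / (x - c) \<le> U"
      unfolding U_def by (rule concave_on_slopes_disjoint[OF f]) (use c x greater in auto)
    then have "f x - f c \<le> U * (x - c)" using greater by (simp add: divide_le_eq)
    also have "\<dots> \<le> (\<bar>U\<bar> + \<bar>V\<bar>) * (r - l)" using c x greater by (intro mult_mono) auto
    finally show ?thesis by linarith
  next
    case equal
    then show ?thesis using c by simp
  next
    case less
    have "V \<le> (f c - f x) / (c - x)"
      unfolding V_def by (rule concave_on_slopes_disjoint[OF f]) (use c x less in auto)
    then have "f x - f c \<le> - V * (c - x)" using less by (simp add: le_divide_eq)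
    also have "\<dots> \<le> (\<bar>U\<bar> + \<bar>V\<bar>) * (r - l)" using c x less by (intro mult_mono) auto
    finally show ?thesis by linarith
  qed
  then show thesis by (rule that)
qed

lemma strict_concave_on_midpoint:
  assumes "strict_concave_on I f" "x \<in> I" "x + 2 * h \<in> I" "0 < h"
  shows "0 < 2 * f (x + h) - f x - f (x + 2 * h)"
proof -
  have "1/2 * f x + (1 - 1/2) * f (x + 2 * h) < f (1/2 * x + (1 - 1/2) * (x + 2 * h))"
    using assms unfolding strict_concave_on_def by (smt (verit) half_gt_zero_iff field_sum_of_halves)
  moreover have "1/2 * x + (1 - 1/2) * (x + 2 * h) = x + h" by (simp add: algebra_simps)
  ultimately show ?thesis by simp
qed

text \<open>The second difference is bounded below by a second difference over two cells of a fixed finite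
  grid, so the constant is uniform although \<open>f\<close> may degenerate at the ends of the interval.\<close>

lemma strict_concave_on_uniform_four_points:
  fixes f :: "real \<Rightarrow> real"
  assumes f: "concave_on {l<..<r} f" and sf: "strict_concave_on {l<..<r} f" and "0 < \<delta>"
  obtains c where "0 < c"
    "\<And>p h d. \<lbrakk>l < p; 0 \<le> h; \<delta> \<le> d; p + h + d < r\<rbrakk>
       \<Longrightarrow> c * h \<le> f (p + h) + f (p + d) - f p - f (p + h + d)"
proof -
  \<comment> \<open>For \<open>h \<le> \<delta> / 2\<close> the points \<open>p + h\<close> and
    \<open>p + \<delta>\<close> are at least \<open>4 * \<eta>\<close> apart: room for rounding
    \<open>p + h\<close> up to the grid, which costs less than \<open>\<eta>\<close>, and for two
    cells.\<close>
  define \<eta> where "\<eta> = \<delta> / 8"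
  define E where "E = (\<lambda>p h d. f (p + h) + f (p + d) - f p - f (p + h + d))"
  have \<eta>: "0 < \<eta>" using assms by (simp add: \<eta>_def)
  \<comment> \<open>The drop of the secant slope from the cell starting at \<open>k * \<eta>\<close>
    to the next one. Finitely many \<open>k\<close> are admissible, so the minimum below is
    positive; its entry 1 covers an empty \<open>A\<close>.\<close>
  define Q where "Q = (\<lambda>k. (2 * f (of_int k * \<eta> + \<eta>) - f (of_int k * \<eta>) - f (of_int k * \<eta> + 2 * \<eta>)) / \<eta>)"
  define A where "A = {k::int. l < of_int k * \<eta> \<and> of_int k * \<eta> + 2 * \<eta> < r}"
  have "A \<subseteq> {\<lfloor>l / \<eta>\<rfloor> .. \<lceil>r / \<eta>\<rceil>}"
  proof
    fix k assume "k \<in> A"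
    then have "l / \<eta> < of_int k" "of_int k < r / \<eta>"
      using \<eta> by (auto simp: A_def divide_less_eq less_divide_eq)
    then show "k \<in> {\<lfloor>l / \<eta>\<rfloor> .. \<lceil>r / \<eta>\<rceil>}" by (auto; linarith)
  qed
  then have "finite A" by (rule finite_subset) simp
  have Qpos: "0 < Q k" if "k \<in> A" for k
    unfolding Q_def using that \<eta>
    by (intro divide_pos_pos strict_concave_on_midpoint[OF sf]) (auto simp: A_def)
  define c where "c = Min (insert 1 (Q ` A))"
  have "0 < c" unfolding c_def using \<open>finite A\<close> Qpos by (subst Min_gr_iff) auto
  have cQ: "c \<le> Q k" if "k \<in> A" for k
    unfolding c_def using that \<open>finite A\<close> by (intro Min_le) auto
  have Edef: "E p h d = f (p + h) + f (p + d) - f p - f (p + h + d)" for p h d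
    by (simp add: E_def)
  \<comment> \<open>The second difference grows in \<open>d\<close>, and by symmetry in
    \<open>h\<close>; this reduces everything to \<open>d = \<delta>\<close> and
    \<open>h \<le> \<delta> / 2\<close>.\<close>
  have Emono_d: "E p h d' \<le> E p h d" if "l < p" "0 \<le> h" "0 \<le> d'" "d' \<le> d" "p + h + d < r" for p h d d'
    using concave_on_four_points[OF f, of "p + d'" h "d - d'"] that by (simp add: Edef algebra_simps)
  have Ecomm: "E p h d = E p d h" for p h d by (simp add: Edef algebra_simps)
  have small: "c * h \<le> E p h \<delta>" if "l < p" "0 \<le> h" "h \<le> \<delta> / 2" "p + h + \<delta> < r" for p h
  proof (cases "h = 0")
    case True then show ?thesis by (simp add: Edef)
  next
    case False
    define k where "k = \<lceil>(p + h) / \<eta>\<rceil>"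
    have k: "p + h \<le> of_int k * \<eta>" "of_int k * \<eta> < p + h + \<eta>"
    proof -
      have "(p + h) / \<eta> \<le> of_int k" "of_int k < (p + h) / \<eta> + 1" unfolding k_def by linarith+
      then show "p + h \<le> of_int k * \<eta>" "of_int k * \<eta> < p + h + \<eta>"
        using \<eta> by (auto simp: divide_le_eq field_simps)
    qed
    have d8: "\<delta> = 8 * \<eta>" by (simp add: \<eta>_def)
    have kA: "k \<in> A" using k that \<eta> False by (auto simp: A_def d8)
    have s1: "(f (of_int k * \<eta> + \<eta>) - f (of_int k * \<eta>)) / \<eta> \<le> (f (p + h) - f p) / h"
      using concave_on_slopes_disjoint[OF f, of p "of_int k * \<eta> + \<eta>" "p + h" "of_int k * \<eta>"] that k \<eta> False d8
      by auto
    have s2: "(f (p + \<delta> + h) - f (p + \<delta>)) / h \<le> (f (of_int k * \<eta> + 2 * \<eta>) - f (of_int k * \<eta> + \<eta>)) / \<eta>"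
      using concave_on_slopes_disjoint[OF f, of "of_int k * \<eta> + \<eta>" "p + \<delta> + h" "of_int k * \<eta> + 2 * \<eta>" "p + \<delta>"] that k \<eta> False d8
      by auto
    have "c \<le> Q k" using cQ kA by blast
    also have "Q k = (f (of_int k * \<eta> + \<eta>) - f (of_int k * \<eta>)) / \<eta> - (f (of_int k * \<eta> + 2 * \<eta>) - f (of_int k * \<eta> + \<eta>)) / \<eta>"
      by (simp add: Q_def diff_divide_distrib[symmetric])
    also have "\<dots> \<le> (f (p + h) - f p) / h - (f (p + \<delta> + h) - f (p + \<delta>)) / h"
      using s1 s2 by linarith
    also have "\<dots> = E p h \<delta> / h"
      by (simp add: Edef diff_divide_distrib[symmetric] algebra_simps)
    finally show ?thesis using False that by (simp add: le_divide_eq)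
  qed
  \<comment> \<open>For \<open>h > \<delta> / 2\<close> only the fixed gain at
    \<open>h = \<delta> / 2\<close> is available; since \<open>h < r - l\<close>, dividing by
    \<open>r - l\<close> turns it into a bound linear in \<open>h\<close>.\<close>
  define c' where "c' = min c (c * (\<delta> / 2) / (r - l))"
  show thesis
  proof (cases "l < r")
    case False
    show ?thesis by (rule that[of 1]) (use False assms in auto)
  next
    case True
    have "0 < c'" using \<open>0 < c\<close> True assms by (simp add: c'_def)
    moreover have "c' * h \<le> E p h d" if "l < p" "0 \<le> h" "\<delta> \<le> d" "p + h + d < r" for p h d
    proof (cases "h \<le> \<delta> / 2")
      case True
      have "c' * h \<le> c * h" using that by (intro mult_right_mono) (auto simp: c'_def)
      also have "\<dots> \<le> E p h \<delta>" by (rule small) (use that True in auto)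
      also have "\<dots> \<le> E p h d" by (rule Emono_d) (use that assms in auto)
      finally show ?thesis .
    next
      case False
      have "c' * h \<le> c * (\<delta> / 2) / (r - l) * h"
        using that by (intro mult_right_mono) (auto simp: c'_def)
      also have "\<dots> \<le> c * (\<delta> / 2) / (r - l) * (r - l)"
        using that assms \<open>0 < c\<close> True by (intro mult_left_mono) auto
      also have "\<dots> = c * (\<delta> / 2)" using \<open>l < r\<close> by (metis diff_gt_0_iff_gt less_irrefl nonzero_eq_divide_eq)
      also have "\<dots> \<le> E p (\<delta> / 2) \<delta>" by (rule small) (use that False assms in auto)
      also have "\<dots> \<le> E p h \<delta>"
        unfolding Ecomm[of p _ \<delta>] by (rule Emono_d) (use that False assms in auto)
      also have "\<dots> \<le> E p h d" by (rule Emono_d) (use that assms in auto)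
      finally show ?thesis .
    qed
    ultimately show ?thesis using that unfolding Edef by blast
  qed
qed

text \<open>If \<open>f\<close> decreased, then so would \<open>x \<mapsto> f x + e x\<close> for small \<open>e > 0\<close>. The image of the null set \<open>N\<close> under this
  Lipschitz function is null, so some intermediate level \<open>v\<close> is attained only outside \<open>N\<close>, and at the last
  point where it is attained the derivative cannot be positive.\<close>

lemma lipschitz_deriv_nonneg_imp_mono:
  fixes f :: "real \<Rightarrow> real"
  assumes "a \<le> b"
    and lip: "\<And>x y. \<lbrakk>x \<in> {a..b}; y \<in> {a..b}\<rbrakk> \<Longrightarrow> \<bar>f x - f y\<bar> \<le> L * \<bar>x - y\<bar>"
    and neg: "negligible N"
    and der: "\<And>x. x \<in> {a..b} - N \<Longrightarrow> \<exists>D\<ge>0. (f has_real_derivative D) (at x)"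
  shows "f a \<le> f b"
proof (rule ccontr)
  assume "\<not> f a \<le> f b"
  then have ab: "f b < f a" "a < b" using \<open>a \<le> b\<close> by (auto simp: less_le)
  \<comment> \<open>Half the average rate of decrease: \<open>g\<close> still decreases from
    \<open>a\<close> to \<open>b\<close>, yet has positive derivative outside
    \<open>N\<close>.\<close>
  define e where "e = (f a - f b) / 2 / (b - a)"
  have e: "0 < e" using ab by (simp add: e_def)
  define g where "g = (\<lambda>x. f x + e * x)"
  have "e * (b - a) = (f a - f b) / 2"
    unfolding e_def using ab by (metis diff_gt_0_iff_gt less_irrefl nonzero_eq_divide_eq)
  then have "e * (b - a) < f a - f b" using ab by simp
  then have gab: "g b < g a" by (simp add: g_def algebra_simps)
  have glip: "\<bar>g x - g y\<bar> \<le> (L + e) * \<bar>x - y\<bar>" if "x \<in> {a..b}" "y \<in> {a..b}" for x y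
  proof -
    have "\<bar>g x - g y\<bar> \<le> \<bar>f x - f y\<bar> + \<bar>e * (x - y)\<bar>" by (simp add: g_def algebra_simps)
    also have "\<dots> \<le> L * \<bar>x - y\<bar> + e * \<bar>x - y\<bar>" using lip[OF that] e by (simp add: abs_mult)
    finally show ?thesis by (simp add: algebra_simps)
  qed
  have "negligible (g ` (N \<inter> {a..b}))"
  proof (rule negligible_locally_Lipschitz_image)
    show "negligible (N \<inter> {a..b})" using neg by (simp add: negligible_Int)
    show "\<exists>T B. open T \<and> x \<in> T \<and> (\<forall>y\<in>(N \<inter> {a..b}) \<inter> T. norm (g y - g x) \<le> B * norm (y - x))"
      if "x \<in> N \<inter> {a..b}" for x
      by (rule exI[of _ UNIV], rule exI[of _ "L + e"]) (use glip that in auto)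
  qed auto
  moreover have "\<not> negligible {g b<..<g a}"
    using gab open_not_negligible[of "{g b<..<g a}"] by auto
  ultimately obtain v where v: "v \<in> {g b<..<g a}" "v \<notin> g ` (N \<inter> {a..b})"
    using negligible_subset by blast
  have gc: "continuous_on {a..b} g"
  proof (rule continuous_on_subset[OF lipschitz_on_continuous_on order_refl])
    show "(max 0 (L + e))-lipschitz_on {a..b} g"
    proof (rule lipschitz_onI)
      fix x y assume "x \<in> {a..b}" "y \<in> {a..b}"
      then have "\<bar>g x - g y\<bar> \<le> (L + e) * \<bar>x - y\<bar>" by (rule glip)
      also have "\<dots> \<le> max 0 (L + e) * \<bar>x - y\<bar>" by (intro mult_right_mono) auto
      finally show "dist (g x) (g y) \<le> max 0 (L + e) * dist x y" by (simp add: dist_real_def)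
    qed simp
  qed
  \<comment> \<open>At the supremum of this superlevel set \<open>g\<close> equals \<open>v\<close>;
    a larger value there would give, by the intermediate value theorem, a later point of the
    set.\<close>
  define S where "S = {x \<in> {a..b}. v \<le> g x}"
  have "closed S" unfolding S_def
    using continuous_closed_preimage[OF gc, of "{v..}"] by (simp add: vimage_def Int_def)
  have "a \<in> S" "bdd_above S" using v ab by (auto simp: S_def bdd_above_def)
  define x where "x = Sup S"
  have "x \<in> S" unfolding x_def using closed_contains_Sup[OF _ \<open>bdd_above S\<close> \<open>closed S\<close>] \<open>a \<in> S\<close> by auto
  then have x: "x \<in> {a..b}" "v \<le> g x" by (auto simp: S_def)
  then have "x < b" using v by (cases "x = b") auto
  have above: "g s < v" if "x < s" "s \<le> b" for s
  proof (rule ccontr)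
    assume "\<not> g s < v"
    then have "s \<in> S" using that x by (auto simp: S_def)
    then show False using cSup_upper[OF _ \<open>bdd_above S\<close>, of s] that by (auto simp: x_def)
  qed
  have "g x = v"
  proof (rule ccontr)
    assume "g x \<noteq> v"
    then have "v < g x" using x by simp
    then obtain s where "x \<le> s" "s \<le> b" "g s = v"
      using IVT2'[of g b v x] v \<open>x < b\<close> continuous_on_subset[OF gc, of "{x..b}"] x by auto
    then show False using above[of s] \<open>v < g x\<close> by (cases "s = x") auto
  qed
  then have "x \<notin> N" using v x by auto
  then obtain D where D: "0 \<le> D" "(f has_real_derivative D) (at x)" using der x by blast
  then have "(g has_real_derivative D + e) (at x)"
    unfolding g_def by (auto intro!: derivative_eq_intros)
  then obtain d where d: "0 < d" "\<And>h. \<lbrakk>0 < h; h < d\<rbrakk> \<Longrightarrow> g x < g (x + h)"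
    using DERIV_pos_inc_right[of g "D + e" x] D e by auto
  define h where "h = min (d / 2) (b - x)"
  have "0 < h" "h < d" "x + h \<le> b" using d \<open>x < b\<close> by (auto simp: h_def)
  then show False using d(2)[of h] above[of "x + h"] \<open>g x = v\<close> by auto
qed

subsection \<open>Kernels\<close>

text \<open>The function \<open>K t - K (t - 1)\<close> is Lipschitz on compact subintervals of
  \<open>(0,1)\<close>, being a difference of concave functions, and \<open>PM 0 K\<close> makes its
  derivative nonnegative almost everywhere, so it is nondecreasing.\<close>

lemma PM_increment:
  assumes neg: "concave_on {-1<..<0} K" and pos: "concave_on {0<..<1} K" and PM: "PM 0 K"
    and b: "0 < b" "0 \<le> h" "b + h < 1"
  shows "K (b + h - 1) - K (b - 1) \<le> K (b + h) - K b"
proof -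
  obtain L1 where L1: "\<And>x y. \<lbrakk>x \<in> {b..b+h}; y \<in> {b..b+h}\<rbrakk> \<Longrightarrow> \<bar>K x - K y\<bar> \<le> L1 * \<bar>x - y\<bar>"
    by (rule concave_on_imp_lipschitz[OF pos, of b "b + h"]) (use b in auto)
  obtain L2 where L2: "\<And>x y. \<lbrakk>x \<in> {b-1..b+h-1}; y \<in> {b-1..b+h-1}\<rbrakk> \<Longrightarrow> \<bar>K x - K y\<bar> \<le> L2 * \<bar>x - y\<bar>"
    by (rule concave_on_imp_lipschitz[OF neg, of "b-1" "b + h-1"]) (use b in auto)
  obtain N where N: "N \<in> null_sets lborel"
    "\<And>t. t \<notin> N \<Longrightarrow> t \<in> {0<..<1} \<longrightarrow> K differentiable (at t) \<and> K differentiable (at (t - 1)) \<and>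
      deriv K t - deriv K (t - 1) \<ge> 0"
    using PM unfolding PM_def eventually_ae_filter by auto
  define f where "f = (\<lambda>t. K t - K (t - 1))"
  have "f b \<le> f (b + h)"
  proof (rule lipschitz_deriv_nonneg_imp_mono[where f = f and a = b and b = "b + h" and L = "L1 + L2" and N = N])
    show "b \<le> b + h" using b by simp
    show "negligible N" using N(1) negligible_iff_null_sets null_sets_completionI by blast
    show "\<bar>f x - f y\<bar> \<le> (L1 + L2) * \<bar>x - y\<bar>" if "x \<in> {b..b+h}" "y \<in> {b..b+h}" for x y
      using L1[OF that] L2[of "x - 1" "y - 1"] that by (simp add: f_def algebra_simps)
    show "\<exists>D\<ge>0. (f has_real_derivative D) (at x)" if "x \<in> {b..b+h} - N" for x
    proof -
      have d: "K differentiable (at x)" "K differentiable (at (x - 1))" "deriv K x - deriv K (x - 1) \<ge> 0"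
        using N(2)[of x] that b by auto
      have d1: "(K has_real_derivative deriv K x) (at x)"
        using d(1) by (simp add: DERIV_deriv_iff_real_differentiable)
      have "(K has_real_derivative deriv K (x - 1)) (at (x - 1))"
        using d(2) by (simp add: DERIV_deriv_iff_real_differentiable)
      then have "((\<lambda>t. K (t - 1)) has_real_derivative deriv K (x - 1)) (at x)"
        using DERIV_shift[of K "deriv K (x-1)" x "-1"] by simp
      from DERIV_diff[OF d1 this] d(3) show ?thesis unfolding f_def by blast
    qed
  qed
  then show ?thesis by (simp add: f_def algebra_simps)
qed

lemma uniform_small_constant:
  fixes P :: "nat \<Rightarrow> real \<Rightarrow> bool"
  assumes "\<And>i. i < n \<Longrightarrow> \<exists>c>0. P i c"
    and "\<And>i c d. \<lbrakk>i < n; P i c; 0 < d; d \<le> c\<rbrakk> \<Longrightarrow> P i d"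
  shows "\<exists>c>0. \<forall>i<n. P i c"
proof -
  obtain f where f: "\<And>i. i < n \<Longrightarrow> 0 < f i \<and> P i (f i)" using assms(1) by metis
  define c where "c = Min (insert 1 (f ` {..<n}))"
  have "0 < c" unfolding c_def using f by (subst Min_gr_iff) auto
  moreover have "c \<le> f i" if "i < n" for i unfolding c_def using that by (intro Min_le) auto
  ultimately show ?thesis using f assms(2) by blast
qed

lemma uniform_large_constant:
  fixes P :: "nat \<Rightarrow> real \<Rightarrow> bool"
  assumes "\<And>i. i < n \<Longrightarrow> \<exists>c. P i c"
    and "\<And>i c d. \<lbrakk>i < n; P i c; c \<le> d\<rbrakk> \<Longrightarrow> P i d"
  shows "\<exists>c\<ge>0. \<forall>i<n. P i c"
proof -
  obtain f where f: "\<And>i. i < n \<Longrightarrow> P i (f i)" using assms(1) by metis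
  define c where "c = Max (insert 0 (f ` {..<n}))"
  have "0 \<le> c" unfolding c_def by (intro Max_ge) auto
  moreover have "f i \<le> c" if "i < n" for i unfolding c_def using that by (intro Max_ge) auto
  ultimately show ?thesis using f assms(2) by blast
qed

text \<open>\<open>kernel_ext\<close> takes the value at 0 from the right; the common one-sided
  limit of a kernel function carries it over to the left.\<close>

lemma singular_kernel_tendsto:
  assumes "kernel_function K" "singular_kernel K"
  shows "((\<lambda>t. ereal (K t)) \<longlongrightarrow> -\<infinity>) (at 0)"
proof -
  obtain L where L: "((\<lambda>t. ereal (K t)) \<longlongrightarrow> L) (at_right 0)" "((\<lambda>t. ereal (K t)) \<longlongrightarrow> L) (at_left 0)"
    using assms(1) by (auto simp: kernel_function_def)
  have "Lim (at_right 0) (\<lambda>t. ereal (K t)) = L"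
    by (rule tendsto_Lim[OF _ L(1)]) simp
  then have "L = -\<infinity>" using assms(2) by (simp add: singular_kernel_def kernel_ext_def)
  then show ?thesis using L by (simp add: filterlim_split_at)
qed

subsection \<open>Sums over sign changes\<close>

text \<open>Discrete derivative of \<open>s 0, ..., s (n - 1)\<close> extended by 0 on both sides,
  so for \<open>n > 0\<close> and signs \<open>s\<close> the indices \<open>0\<close> and
  \<open>n\<close> always count as sign changes.\<close>

definition sign_jump :: "nat \<Rightarrow> (nat \<Rightarrow> real) \<Rightarrow> nat \<Rightarrow> real" where
  "sign_jump n s j = (if j < n then s j else 0) - (if 0 < j then s (j - 1) else 0)"

text \<open>Summation by parts; the zero extension leaves no boundary terms.\<close>

lemma sum_sign_jump:
  "(\<Sum>j\<le>n. sign_jump n s j * x j) = (\<Sum>i<n. s i * (x i - x (Suc i)))"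
proof -
  have "(\<Sum>j\<le>n. sign_jump n s j * x j)
      = (\<Sum>j<Suc n. (if j < n then s j else 0) * x j) - (\<Sum>j<Suc n. (if 0 < j then s (j - 1) else 0) * x j)"
    unfolding lessThan_Suc_atMost by (simp add: sign_jump_def left_diff_distrib sum_subtractf)
  also have "(\<Sum>j<Suc n. (if j < n then s j else 0) * x j) = (\<Sum>j<n. s j * x j)" by simp
  also have "(\<Sum>j<Suc n. (if 0 < j then s (j - 1) else 0) * x j) = (\<Sum>j<n. s j * x (Suc j))"
    by (subst sum.lessThan_Suc_shift) simp
  finally show ?thesis by (simp add: right_diff_distrib sum_subtractf)
qed

text \<open>The largest index up to \<open>j\<close> at which \<open>a\<close> does not vanish; the
  default 0 is correct as soon as \<open>a 0 \<noteq> 0\<close>.\<close>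

primrec last_jump :: "(nat \<Rightarrow> real) \<Rightarrow> nat \<Rightarrow> nat" where
  "last_jump a 0 = 0"
| "last_jump a (Suc j) = (if a (Suc j) \<noteq> 0 then Suc j else last_jump a j)"

lemma last_jump_le: "last_jump a j \<le> j"
  by (induction j) (auto intro: le_SucI)

lemma last_jump_nonzero: "a 0 \<noteq> 0 \<Longrightarrow> a (last_jump a j) \<noteq> 0"
  by (induction j) auto

lemma last_jump_self: "a j \<noteq> 0 \<Longrightarrow> last_jump a j = j"
  by (cases j) auto

lemma zero_after_last_jump: "\<lbrakk>last_jump a j < k; k \<le> j\<rbrakk> \<Longrightarrow> a k = 0"
  by (induction j) (auto simp: le_Suc_eq split: if_splits)

text \<open>Between sign changes the values \<open>x\<close> are irrelevant, so they may be replaced by the value at the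
  last sign change; then every step except those with the sign of \<open>i\<close> goes in the favourable direction.\<close>

lemma sum_sign_jump_ge:
  fixes s x :: "nat \<Rightarrow> real"
  assumes s: "\<And>k. s k = 1 \<or> s k = -1" and i: "i < n"
    and left: "\<And>j k. \<lbrakk>j < k; k \<le> i; sign_jump n s j \<noteq> 0; sign_jump n s k \<noteq> 0\<rbrakk> \<Longrightarrow> s i * x j \<le> s i * x k"
    and right: "\<And>j k. \<lbrakk>i < j; j < k; k \<le> n; sign_jump n s j \<noteq> 0; sign_jump n s k \<noteq> 0\<rbrakk> \<Longrightarrow> s i * x j \<le> s i * x k"
  shows "s i * (x 0 - x n) \<le> (\<Sum>j\<le>n. sign_jump n s j * x j)"
proof -
  define a where "a = sign_jump n s"
  define p where "p = last_jump a"
  have a0: "a 0 \<noteq> 0" and an: "a n \<noteq> 0"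
    using s[of 0] s[of "n - 1"] i by (auto simp: a_def sign_jump_def)
  have ap: "a (p j) \<noteq> 0" for j unfolding p_def by (rule last_jump_nonzero[of a, OF a0])
  have step: "s i * (x (p b) - x (p (Suc b))) \<le> s b * (x (p b) - x (p (Suc b)))" if b: "b < n" for b
  proof (cases "s b = s i \<or> p (Suc b) = p b")
    case True then show ?thesis by auto
  next
    case False
    then have pS: "p (Suc b) = Suc b" by (auto simp: p_def split: if_splits)
    have sb: "s b = - s i" using False s[of b] s[of i] by auto
    have pb: "p b \<le> b" by (simp add: p_def last_jump_le)
    have jumps: "sign_jump n s (p b) \<noteq> 0" "sign_jump n s (Suc b) \<noteq> 0"
      using ap[of b] ap[of "Suc b"] pS by (auto simp: a_def)
    \<comment> \<open>No jump occurs after \<open>p b\<close> up to \<open>b\<close>, so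
      \<open>s\<close> is constant there; an \<open>i\<close> in this range would give
      \<open>s b = s i\<close>. Hence the step lies entirely on one side of
      \<open>i\<close>.\<close>
    have "\<not> (p b \<le> i \<and> i \<le> b)"
    proof
      assume bi: "p b \<le> i \<and> i \<le> b"
      have "i + d \<le> b \<longrightarrow> s (i + d) = s i" for d
      proof (induction d)
        case (Suc d)
        show ?case
        proof
          assume d: "i + Suc d \<le> b"
          have "last_jump a b < Suc (i + d)" using bi unfolding p_def by linarith
          then have "a (Suc (i + d)) = 0" using d by (intro zero_after_last_jump[of a b]) auto
          then have "s (Suc (i + d)) = s (i + d)" using d b unfolding a_def sign_jump_def by auto
          then show "s (i + Suc d) = s i" using Suc d by auto
        qed
      qed simp
      from this[of "b - i"] show False using bi False by auto
    qed
    then consider "Suc b \<le> i" | "i < p b" by linarith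
    then have "s i * x (p b) \<le> s i * x (p (Suc b))"
    proof cases
      case 1 then show ?thesis using left[of "p b" "Suc b"] pb pS jumps by auto
    next
      case 2 then show ?thesis using right[of "p b" "Suc b"] pb pS jumps b by auto
    qed
    then show ?thesis unfolding sb by (simp add: algebra_simps)
  qed
  have "s i * (x 0 - x n) = s i * (x (p 0) - x (p n))"
    using last_jump_self[of a n, OF an] by (simp add: p_def)
  also have "\<dots> = (\<Sum>b<n. s i * (x (p b) - x (p (Suc b))))"
    using sum_lessThan_telescope'[of "\<lambda>b. x (p b)" n] by (simp only: sum_distrib_left[symmetric])
  also have "\<dots> \<le> (\<Sum>b<n. s b * (x (p b) - x (p (Suc b))))"
    by (intro sum_mono step) auto
  \<comment> \<open>Summation by parts backwards; wherever \<open>a j \<noteq> 0\<close>, one has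
    \<open>p j = j\<close>, so the replaced values disappear again.\<close>
  also have "\<dots> = (\<Sum>j\<le>n. a j * x (p j))"
    unfolding a_def sum_sign_jump[of n s "\<lambda>j. x (p j)"] ..
  also have "\<dots> = (\<Sum>j\<le>n. a j * x j)"
  proof (rule sum.cong[OF refl])
    fix j show "a j * x (p j) = a j * x j"
      using last_jump_self[of a j] by (cases "a j = 0") (auto simp: p_def)
  qed
  finally show ?thesis by (simp add: a_def)
qed

subsection \<open>The \<open>\<ell>\<^sup>1\<close> and Euclidean distances\<close>

lemma coordinate_le_edist: "i < n \<Longrightarrow> \<bar>a i - b i\<bar> \<le> edist n a b"
  using member_le_L2_set[of "{..<n}" i "\<lambda>i. \<bar>a i - b i\<bar>"] by (simp add: edist_def L2_set_def)

lemma L1_le_edist: "(\<Sum>i<n. \<bar>a i - b i\<bar>) \<le> real n * edist n a b"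
  using sum_bounded_above[of "{..<n}" "\<lambda>i. \<bar>a i - b i\<bar>" "edist n a b"] coordinate_le_edist by simp

lemma edist_le_L1: "edist n a b \<le> (\<Sum>i<n. \<bar>a i - b i\<bar>)"
  unfolding edist_def by (rule L2_set_le_sum_abs)

subsection \<open>Sums of translates\<close>

locale translates =
  fixes n :: nat and K :: "nat \<Rightarrow> real \<Rightarrow> real" and J :: "real \<Rightarrow> ereal"
  assumes kern: "\<And>i. i < n \<Longrightarrow> kernel_function (K i) \<and> singular_kernel (K i) \<and>
                         strictly_concave_kernel (K i) \<and> PM 0 (K i)"
    and field: "field_function n J"
    and infty: "(J 0 = -\<infinity> \<and> (J \<longlongrightarrow> -\<infinity>) (at_right 0)) \<or>
                (J 1 = -\<infinity> \<and> (J \<longlongrightarrow> -\<infinity>) (at_left 1))"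
begin

section \<open>Uniform estimates for finitely many kernels\<close>

lemma concave_neg: "i < n \<Longrightarrow> concave_on {-1<..<0} (K i)"
  and concave_pos: "i < n \<Longrightarrow> concave_on {0<..<1} (K i)"
  using kern by (auto simp: kernel_function_def)

lemma kernel_bounded_above:
  obtains \<kappa> where "0 \<le> \<kappa>" "\<And>i x. \<lbrakk>i < n; 0 < \<bar>x\<bar>; \<bar>x\<bar> < 1\<rbrakk> \<Longrightarrow> K i x \<le> \<kappa>"
proof -
  have "\<exists>\<kappa>\<ge>0. \<forall>i<n. \<forall>x. 0 < \<bar>x\<bar> \<and> \<bar>x\<bar> < 1 \<longrightarrow> K i x \<le> \<kappa>"
  proof (rule uniform_large_constant)
    fix i assume "i < n"
    obtain a where a: "\<And>x. x \<in> {-1<..<0} \<Longrightarrow> K i x \<le> a"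
      using concave_on_imp_bounded_above[OF concave_neg[OF \<open>i < n\<close>]] by auto
    obtain b where b: "\<And>x. x \<in> {0<..<1} \<Longrightarrow> K i x \<le> b"
      using concave_on_imp_bounded_above[OF concave_pos[OF \<open>i < n\<close>]] by auto
    show "\<exists>\<kappa>. \<forall>x. 0 < \<bar>x\<bar> \<and> \<bar>x\<bar> < 1 \<longrightarrow> K i x \<le> \<kappa>"
    proof (intro exI allI impI)
      fix x :: real assume x: "0 < \<bar>x\<bar> \<and> \<bar>x\<bar> < 1"
      show "K i x \<le> max a b"
        using a[of x] b[of x] x by (cases "x < 0") (auto simp: le_max_iff_disj)
    qed
  qed force
  then show thesis using that by blast
qed

lemma kernel_small_near_0:
  obtains \<eta> where "0 < \<eta>" "\<eta> < 1" "\<And>i x. \<lbrakk>i < n; 0 < \<bar>x\<bar>; \<bar>x\<bar> < \<eta>\<rbrakk> \<Longrightarrow> K i x < B"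
proof -
  have "\<exists>\<eta>>0. \<forall>i<n. \<forall>x. 0 < \<bar>x\<bar> \<and> \<bar>x\<bar> < \<eta> \<longrightarrow> K i x < B"
  proof (rule uniform_small_constant)
    fix i assume "i < n"
    then have "((\<lambda>t. ereal (K i t)) \<longlongrightarrow> -\<infinity>) (at 0)"
      using kern singular_kernel_tendsto by blast
    then have "\<forall>\<^sub>F t in at 0. ereal (K i t) < ereal B"
      by (rule order_tendstoD) simp
    then show "\<exists>\<eta>>0. \<forall>x. 0 < \<bar>x\<bar> \<and> \<bar>x\<bar> < \<eta> \<longrightarrow> K i x < B"
      by (auto simp: eventually_at)
  qed auto
  then obtain \<eta> where "0 < \<eta>" "\<forall>i<n. \<forall>x. 0 < \<bar>x\<bar> \<and> \<bar>x\<bar> < \<eta> \<longrightarrow> K i x < B" by blast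
  then show thesis by (intro that[of "min \<eta> (1/2)"]) auto
qed

lemma kernel_lipschitz:
  assumes "0 < \<eta>"
  obtains L where "0 \<le> L"
    "\<And>i x y. \<lbrakk>i < n; x \<in> {\<eta>..1-\<eta>} \<and> y \<in> {\<eta>..1-\<eta>} \<or> x \<in> {\<eta>-1..-\<eta>} \<and> y \<in> {\<eta>-1..-\<eta>}\<rbrakk>
       \<Longrightarrow> \<bar>K i x - K i y\<bar> \<le> L * \<bar>x - y\<bar>"
proof (cases "\<eta> \<le> 1 - \<eta>")
  case False
  then show ?thesis by (intro that[of 0]) auto
next
  case True
  have "\<exists>L\<ge>0. \<forall>i<n. \<forall>x y. x \<in> {\<eta>..1-\<eta>} \<and> y \<in> {\<eta>..1-\<eta>} \<or> x \<in> {\<eta>-1..-\<eta>} \<and> y \<in> {\<eta>-1..-\<eta>}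
       \<longrightarrow> \<bar>K i x - K i y\<bar> \<le> L * \<bar>x - y\<bar>"
  proof (rule uniform_large_constant)
    fix i assume i: "i < n"
    obtain a where a: "0 \<le> a" "\<And>x y. \<lbrakk>x \<in> {\<eta>-1..-\<eta>}; y \<in> {\<eta>-1..-\<eta>}\<rbrakk> \<Longrightarrow> \<bar>K i x - K i y\<bar> \<le> a * \<bar>x - y\<bar>"
      by (rule concave_on_imp_lipschitz[OF concave_neg[OF i], of "\<eta>-1" "-\<eta>"]) (use True assms in auto)
    obtain b where b: "0 \<le> b" "\<And>x y. \<lbrakk>x \<in> {\<eta>..1-\<eta>}; y \<in> {\<eta>..1-\<eta>}\<rbrakk> \<Longrightarrow> \<bar>K i x - K i y\<bar> \<le> b * \<bar>x - y\<bar>"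
      by (rule concave_on_imp_lipschitz[OF concave_pos[OF i], of "\<eta>" "1-\<eta>"]) (use True assms in auto)
    have "\<bar>K i x - K i y\<bar> \<le> (a + b) * \<bar>x - y\<bar>"
      if "x \<in> {\<eta>..1-\<eta>} \<and> y \<in> {\<eta>..1-\<eta>} \<or> x \<in> {\<eta>-1..-\<eta>} \<and> y \<in> {\<eta>-1..-\<eta>}" for x y
    proof -
      have "0 \<le> a * \<bar>x - y\<bar>" "0 \<le> b * \<bar>x - y\<bar>" using a(1) b(1) by auto
      then show ?thesis using a(2)[of x y] b(2)[of x y] that by (auto simp: distrib_right)
    qed
    then show "\<exists>L. \<forall>x y. x \<in> {\<eta>..1-\<eta>} \<and> y \<in> {\<eta>..1-\<eta>} \<or> x \<in> {\<eta>-1..-\<eta>} \<and> y \<in> {\<eta>-1..-\<eta>}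
       \<longrightarrow> \<bar>K i x - K i y\<bar> \<le> L * \<bar>x - y\<bar>"
      by blast
  next
    fix i c d assume "\<forall>x y. x \<in> {\<eta>..1-\<eta>} \<and> y \<in> {\<eta>..1-\<eta>} \<or> x \<in> {\<eta>-1..-\<eta>} \<and> y \<in> {\<eta>-1..-\<eta>}
       \<longrightarrow> \<bar>K i x - K i y\<bar> \<le> c * \<bar>x - y\<bar>" and "c \<le> d"
    moreover have "c * \<bar>x - y\<bar> \<le> d * \<bar>x - y\<bar>" for x y using \<open>c \<le> d\<close> by (intro mult_right_mono) auto
    ultimately show "\<forall>x y. x \<in> {\<eta>..1-\<eta>} \<and> y \<in> {\<eta>..1-\<eta>} \<or> x \<in> {\<eta>-1..-\<eta>} \<and> y \<in> {\<eta>-1..-\<eta>}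
       \<longrightarrow> \<bar>K i x - K i y\<bar> \<le> d * \<bar>x - y\<bar>"
      using order_trans by blast
  qed
  then show thesis using that by blast
qed

lemma kernel_bounded_below:
  assumes "0 < \<eta>"
  obtains B where "\<And>i x. \<lbrakk>i < n; \<eta> \<le> \<bar>x\<bar>; \<bar>x\<bar> \<le> 1 - \<eta>\<rbrakk> \<Longrightarrow> B \<le> K i x"
proof -
  \<comment> \<open>Written with \<open>- B\<close> so that enlarging the constant preserves the
    property, as \<open>uniform_large_constant\<close> demands.\<close>
  have "\<exists>B\<ge>0. \<forall>i<n. \<forall>x. \<eta> \<le> \<bar>x\<bar> \<and> \<bar>x\<bar> \<le> 1 - \<eta> \<longrightarrow> - B \<le> K i x"
  proof (rule uniform_large_constant)
    fix i assume i: "i < n"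
    have "min (min (K i \<eta>) (K i (1 - \<eta>))) (min (K i (\<eta> - 1)) (K i (- \<eta>))) \<le> K i x"
      if x: "\<eta> \<le> \<bar>x\<bar> \<and> \<bar>x\<bar> \<le> 1 - \<eta>" for x
    proof (cases "x < 0")
      case True
      have "concave_on {\<eta> - 1..- \<eta>} (K i)"
        unfolding concave_on_def
        by (rule convex_on_subset[OF concave_neg[OF i, unfolded concave_on_def]]) (use assms in auto)
      from concave_on_ge_min[OF this, of x] x True show ?thesis by auto
    next
      case False
      have "concave_on {\<eta>..1 - \<eta>} (K i)"
        unfolding concave_on_def
        by (rule convex_on_subset[OF concave_pos[OF i, unfolded concave_on_def]]) (use assms in auto)
      from concave_on_ge_min[OF this, of x] x False show ?thesis by auto
    qed
    then show "\<exists>B. \<forall>x. \<eta> \<le> \<bar>x\<bar> \<and> \<bar>x\<bar> \<le> 1 - \<eta> \<longrightarrow> - B \<le> K i x"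
      by (metis minus_minus)
  qed force
  then show thesis using that by blast
qed

lemma kernel_uniformly_strict:
  assumes "0 < \<delta>"
  obtains c where "0 < c"
    "\<And>i p h d. \<lbrakk>i < n; - 1 < p; 0 \<le> h; \<delta> \<le> d; p + h + d < 0\<rbrakk>
       \<Longrightarrow> c * h \<le> K i (p + h) + K i (p + d) - K i p - K i (p + h + d)"
proof -
  have "\<exists>c>0. \<forall>i<n. \<forall>p h d. - 1 < p \<and> 0 \<le> h \<and> \<delta> \<le> d \<and> p + h + d < 0
       \<longrightarrow> c * h \<le> K i (p + h) + K i (p + d) - K i p - K i (p + h + d)"
  proof (rule uniform_small_constant)
    fix i assume i: "i < n"
    then have "strict_concave_on {-1<..<0} (K i)" using kern by (simp add: strictly_concave_kernel_def)
    from strict_concave_on_uniform_four_points[OF concave_neg[OF i] this assms]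
    show "\<exists>c>0. \<forall>p h d. - 1 < p \<and> 0 \<le> h \<and> \<delta> \<le> d \<and> p + h + d < 0
       \<longrightarrow> c * h \<le> K i (p + h) + K i (p + d) - K i p - K i (p + h + d)"
      by metis
  next
    fix i c d' assume "\<forall>p h d. - 1 < p \<and> 0 \<le> h \<and> \<delta> \<le> d \<and> p + h + d < 0
       \<longrightarrow> c * h \<le> K i (p + h) + K i (p + d) - K i p - K i (p + h + d)" "0 < d'" "d' \<le> c"
    then show "\<forall>p h d. - 1 < p \<and> 0 \<le> h \<and> \<delta> \<le> d \<and> p + h + d < 0
       \<longrightarrow> d' * h \<le> K i (p + h) + K i (p + d) - K i p - K i (p + h + d)"
      by (meson mult_right_mono order_trans)
  qed
  then show thesis using that by blast
qed

section \<open>Cells and the suprema over them\<close>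

lemma J_bounded:
  obtains M where "\<And>t. t \<in> {0..1} \<Longrightarrow> J t \<le> ereal M"
  using field unfolding field_function_def by blast

text \<open>On \<open>cell y j\<close> the value \<open>F(y,t)\<close> is the real number \<open>val y t\<close>. On the rest of \<open>I\<^sub>j y\<close> it is \<open>-\<infinity>\<close>.\<close>

definition cell :: "(nat \<Rightarrow> real) \<Rightarrow> nat \<Rightarrow> real set" where
  "cell y j = {t \<in> {0..1}. J t \<noteq> -\<infinity> \<and> (\<forall>i<n. (i < j \<longrightarrow> y i < t) \<and> (j \<le> i \<longrightarrow> t < y i))}"

definition val :: "(nat \<Rightarrow> real) \<Rightarrow> real \<Rightarrow> real" where
  "val y t = real_of_ereal (J t) + (\<Sum>i<n. K i (t - y i))"

text \<open>\<open>real_of_ereal\<close> returns 0 at infinite values, so \<open>m y j\<close> is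
  meaningful only for a nonempty \<open>cell y j\<close>.\<close>

definition m :: "(nat \<Rightarrow> real) \<Rightarrow> nat \<Rightarrow> real" where
  "m y j = real_of_ereal (mfun n J K y j)"

lemma simplexD:
  assumes "y \<in> simplexS n" "i < n"
  shows "0 < y i" "y i < 1" "\<And>k. \<lbrakk>i \<le> k; k < n\<rbrakk> \<Longrightarrow> y i \<le> y k" "\<And>k. \<lbrakk>i < k; k < n\<rbrakk> \<Longrightarrow> y i < y k"
proof -
  show "0 < y i" "y i < 1" and *: "\<And>k. \<lbrakk>i < k; k < n\<rbrakk> \<Longrightarrow> y i < y k"
    using assms by (auto simp: simplexS_def)
  show "y i \<le> y k" if "i \<le> k" "k < n" for k
    using *[of k] that by (cases "i = k") auto
qed

text \<open>Away from the nodes the inequalities of the closed interval become strict, and the order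
  of the nodes extends them from the two neighbouring nodes to all others.\<close>

lemma cell_interval:
  assumes y: "y \<in> simplexS n" and j: "j \<le> n"
  shows "cell y j = {t \<in> {node n y j..node n y (Suc j)}. J t \<noteq> -\<infinity> \<and> (\<forall>i<n. t \<noteq> y i)}" (is "_ = ?R")
proof (intro Set.set_eqI iffI)
  fix t assume t: "t \<in> cell y j"
  then have "node n y j \<le> t" "t \<le> node n y (Suc j)"
    using j by (auto simp: cell_def node_def less_imp_le)
  moreover have "t \<noteq> y i" if "i < n" for i
    using t that by (cases "i < j") (auto simp: cell_def)
  ultimately show "t \<in> ?R" using t by (auto simp: cell_def)
next
  fix t assume t: "t \<in> ?R"
  have *: "0 \<le> node n y j" "node n y (Suc j) \<le> 1"
    using simplexD[OF y] j by (auto simp: node_def less_imp_le)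
  have "y i < t" if "i < n" "i < j" for i
  proof -
    have "y i \<le> node n y j"
      using that simplexD(3)[OF y that(1), of "j - 1"] j by (auto simp: node_def)
    then show ?thesis using t that by (auto simp: less_le)
  qed
  moreover have "t < y i" if "i < n" "j \<le> i" for i
  proof -
    have "node n y (Suc j) \<le> y i"
      using that simplexD(3)[OF y, of j i] by (auto simp: node_def)
    then show ?thesis using t that by (force simp: less_le)
  qed
  ultimately show "t \<in> cell y j" using t * by (auto simp: cell_def)
qed

text \<open>Since \<open>y i\<close> lies strictly between 0 and 1, the argument
  \<open>t - y i\<close> avoids \<open>1\<close> and \<open>-1\<close>, and it avoids
  \<open>0\<close> by assumption; so only the last branch of \<open>kernel_ext\<close>
  occurs.\<close>

lemma Ffun_finite:
  assumes y: "y \<in> simplexS n" and t: "t \<in> {0..1}" "J t \<noteq> -\<infinity>" "\<forall>i<n. t \<noteq> y i"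
  shows "Ffun n J K y t = ereal (val y t)"
proof -
  have "kernel_ext (K i) (t - y i) = ereal (K i (t - y i))" if "i < n" for i
    using simplexD[OF y that] t that by (auto simp: kernel_ext_def)
  then have "(\<Sum>i<n. kernel_ext (K i) (t - y i)) = ereal (\<Sum>i<n. K i (t - y i))" by simp
  moreover obtain M where "J t \<le> ereal M" using J_bounded t by blast
  then have "J t = ereal (real_of_ereal (J t))" using t by (cases "J t") auto
  ultimately show ?thesis unfolding Ffun_def val_def by (metis plus_ereal.simps(1))
qed

text \<open>In \<open>ereal\<close> the value \<open>\<infinity>\<close> absorbs
  \<open>-\<infinity>\<close>, so the other summands must first be shown to differ from
  \<open>\<infinity>\<close>.\<close>

lemma Ffun_infinite:
  assumes y: "y \<in> simplexS n" and t: "t \<in> {0..1}" "J t = -\<infinity> \<or> (\<exists>i<n. t = y i)"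
  shows "Ffun n J K y t = -\<infinity>"
proof -
  have 0: "kernel_ext (K i) 0 = -\<infinity>" if "i < n" for i using kern that by (simp add: singular_kernel_def)
  have k: "kernel_ext (K i) (t - y i) \<noteq> \<infinity>" if "i < n" for i
    using simplexD[OF y that] t that 0[OF that] by (cases "t = y i") (auto simp: kernel_ext_def)
  then have s: "(\<Sum>i\<in>A. kernel_ext (K i) (t - y i)) \<noteq> \<infinity>" if "A \<subseteq> {..<n}" for A
    using that by (auto simp: sum_Pinfty)
  obtain M where "J t \<le> ereal M" using J_bounded t by blast
  then have Jt: "J t \<noteq> \<infinity>" by auto
  show ?thesis
  proof (cases "J t = -\<infinity>")
    case True
    then show ?thesis using s[of "{..<n}"] by (cases "\<Sum>i<n. kernel_ext (K i) (t - y i)") (auto simp: Ffun_def)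
  next
    case False
    then obtain i where i: "i < n" "t = y i" using t by blast
    have "(\<Sum>i<n. kernel_ext (K i) (t - y i)) = kernel_ext (K i) (t - y i) + (\<Sum>i\<in>{..<n}-{i}. kernel_ext (K i) (t - y i))"
      using i by (intro sum.remove) auto
    also have "\<dots> = -\<infinity>" using s[of "{..<n}-{i}"] i 0
      by (cases "\<Sum>i\<in>{..<n}-{i}. kernel_ext (K i) (t - y i)") auto
    finally show ?thesis using Jt by (cases "J t") (auto simp: Ffun_def)
  qed
qed

text \<open>Points outside the cell have value \<open>-\<infinity>\<close> and cannot exceed a real
  number. This replaces the supremum in \<open>ereal\<close> by real inequalities.\<close>

lemma less_mfun_iff:
  assumes y: "y \<in> simplexS n" and j: "j \<le> n"
  shows "ereal a < mfun n J K y j \<longleftrightarrow> (\<exists>t\<in>cell y j. a < val y t)"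
proof -
  have sub: "{node n y j..node n y (Suc j)} \<subseteq> {0..1}"
  proof -
    have "0 \<le> node n y j" "node n y (Suc j) \<le> 1"
      using simplexD[OF y] j by (auto simp: node_def less_imp_le)
    then show ?thesis by auto
  qed
  have "ereal a < mfun n J K y j \<longleftrightarrow> (\<exists>t\<in>{node n y j..node n y (Suc j)}. ereal a < Ffun n J K y t)"
    by (simp add: mfun_def less_SUP_iff)
  also have "\<dots> \<longleftrightarrow> (\<exists>t\<in>cell y j. ereal a < Ffun n J K y t)"
  proof -
    have "t \<in> cell y j" if "t \<in> {node n y j..node n y (Suc j)}" "ereal a < Ffun n J K y t" for t
    proof -
      have "Ffun n J K y t \<noteq> -\<infinity>" using that by auto
      then show ?thesis using Ffun_infinite[OF y, of t] sub that unfolding cell_interval[OF y j] by blast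
    qed
    then show ?thesis unfolding cell_interval[OF y j] by blast
  qed
  also have "\<dots> \<longleftrightarrow> (\<exists>t\<in>cell y j. ereal a < ereal (val y t))"
    using Ffun_finite[OF y] sub unfolding cell_interval[OF y j] by (intro bex_cong refl) auto
  finally show ?thesis by simp
qed

text \<open>All kernels and \<open>J\<close> have common upper bounds. The second and third bound
  leave one summand unestimated, which later makes the value small: a kernel near its node, or
  \<open>J\<close> near the end where it tends to \<open>-\<infinity>\<close>.\<close>

lemma val_bounded_above:
  obtains M where "\<And>y j t. \<lbrakk>y \<in> simplexS n; t \<in> cell y j\<rbrakk> \<Longrightarrow> val y t \<le> M"
    "\<And>y j t i. \<lbrakk>y \<in> simplexS n; t \<in> cell y j; i < n\<rbrakk> \<Longrightarrow> val y t \<le> M + K i (t - y i)"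
    "\<And>y j t. \<lbrakk>y \<in> simplexS n; t \<in> cell y j\<rbrakk> \<Longrightarrow> val y t \<le> M + real_of_ereal (J t)"
proof -
  obtain M where M: "\<And>t. t \<in> {0..1} \<Longrightarrow> J t \<le> ereal M" using J_bounded by blast
  obtain \<kappa> where \<kappa>: "0 \<le> \<kappa>" "\<And>i x. \<lbrakk>i < n; 0 < \<bar>x\<bar>; \<bar>x\<bar> < 1\<rbrakk> \<Longrightarrow> K i x \<le> \<kappa>"
    using kernel_bounded_above by blast
  have Kk: "K i (t - y i) \<le> \<kappa>" if "y \<in> simplexS n" "t \<in> cell y j" "i < n" for y t i j
  proof (rule \<kappa>(2)[OF that(3)])
    have "t \<noteq> y i" using that by (cases "i < j") (auto simp: cell_def)
    then show "0 < \<bar>t - y i\<bar>" by simp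
    show "\<bar>t - y i\<bar> < 1" using simplexD[OF that(1,3)] that(2) by (auto simp: cell_def)
  qed
  have JM: "real_of_ereal (J t) \<le> M" if "t \<in> cell y j" for y t j
    using M[of t] that by (cases "J t") (auto simp: cell_def)
  have sumk: "(\<Sum>i\<in>A. K i (t - y i)) \<le> n * \<kappa>" if "y \<in> simplexS n" "t \<in> cell y j" "A \<subseteq> {..<n}" for y t j A
  proof -
    have "(\<Sum>i\<in>A. K i (t - y i)) \<le> (\<Sum>i\<in>A. \<kappa>)" using Kk[OF that(1,2)] that by (intro sum_mono) auto
    also have "\<dots> \<le> (\<Sum>i<n. \<kappa>)" using that \<kappa> by (intro sum_mono2) auto
    finally show ?thesis by simp
  qed
  show thesis
  proof (rule that[of "\<bar>M\<bar> + n * \<kappa>"])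
    fix y j t assume yt: "y \<in> simplexS n" "t \<in> cell y j"
    show "val y t \<le> \<bar>M\<bar> + n * \<kappa>" "val y t \<le> \<bar>M\<bar> + n * \<kappa> + real_of_ereal (J t)"
      using sumk[OF yt, of "{..<n}"] JM[OF yt(2)] by (auto simp: val_def)
  next
    fix y j t i assume yt: "y \<in> simplexS n" "t \<in> cell y j" "i < n"
    have "(\<Sum>i<n. K i (t - y i)) = K i (t - y i) + (\<Sum>i\<in>{..<n}-{i}. K i (t - y i))"
      using yt by (intro sum.remove) auto
    then show "val y t \<le> \<bar>M\<bar> + n * \<kappa> + K i (t - y i)"
      using sumk[OF yt(1,2), of "{..<n}-{i}"] JM[OF yt(2)] by (auto simp: val_def)
  qed
qed

lemma mfun_finite:
  assumes y: "y \<in> simplexS n" and j: "j \<le> n" 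
  shows "mfun n J K y j \<noteq> -\<infinity> \<longleftrightarrow> cell y j \<noteq> {}"
    and "cell y j \<noteq> {} \<Longrightarrow> mfun n J K y j = ereal (m y j)"
proof -
  obtain M where M: "\<And>t. t \<in> cell y j \<Longrightarrow> val y t \<le> M" using val_bounded_above y by metis
  have "\<not> ereal M < mfun n J K y j" using less_mfun_iff[OF y j] M by force
  then have ub: "mfun n J K y j \<noteq> \<infinity>" by auto
  show eq: "mfun n J K y j \<noteq> -\<infinity> \<longleftrightarrow> cell y j \<noteq> {}"
  proof
    assume "mfun n J K y j \<noteq> -\<infinity>"
    then have "\<exists>a. ereal a < mfun n J K y j" by (metis ereal_dense2 ereal_infty_less(2))
    then show "cell y j \<noteq> {}" using less_mfun_iff[OF y j] by blast
  next
    assume "cell y j \<noteq> {}"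
    then obtain t where "t \<in> cell y j" by blast
    then have "ereal (val y t - 1) < mfun n J K y j" using less_mfun_iff[OF y j] by force
    then show "mfun n J K y j \<noteq> -\<infinity>" by auto
  qed
  show "mfun n J K y j = ereal (m y j)" if "cell y j \<noteq> {}"
    using eq ub that unfolding m_def by (cases "mfun n J K y j") auto
qed

lemma m_upper:
  assumes y: "y \<in> simplexS n" and j: "j \<le> n" and t: "t \<in> cell y j"
  shows "val y t \<le> m y j"
proof -
  have "\<not> m y j < val y t"
    using less_mfun_iff[OF y j, of "m y j"] mfun_finite(2)[OF y j] t by force
  then show ?thesis by simp
qed

text \<open>\<open>J\<close> carries no semicontinuity, so the supremum need not be attained;
  near-maximal points stand in for maximal ones throughout.\<close>

lemma m_near:
  assumes y: "y \<in> simplexS n" and j: "j \<le> n" and ne: "cell y j \<noteq> {}" and a: "a < m y j"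
  obtains t where "t \<in> cell y j" "a < val y t"
  using less_mfun_iff[OF y j, of a] mfun_finite(2)[OF y j ne] a by auto

lemma Yset_iff: "y \<in> Yset n J K \<longleftrightarrow> y \<in> simplexS n \<and> (\<forall>j\<le>n. cell y j \<noteq> {})"
  using mfun_finite(1) by (auto simp: Yset_def)

lemma Phi_eq:
  assumes "y \<in> Yset n J K" "i < n"
  shows "Phi n J K y i = m y (Suc i) - m y i"
  using assms mfun_finite(2)[of y "Suc i"] mfun_finite(2)[of y i] by (auto simp: Phi_def Yset_iff)

section \<open>Near-maximal points under perturbation of the nodes\<close>

text \<open>A node too close to \<open>t\<close> pushes its kernel below \<open>B - M\<close>, which
  \<open>val y t \<le> M + K i (t - y i)\<close> forbids.\<close>

lemma cell_separated:
  obtains \<eta> where "0 < \<eta>" "\<eta> < 1"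
    "\<And>y j t i. \<lbrakk>y \<in> simplexS n; t \<in> cell y j; B \<le> val y t; i < n\<rbrakk> \<Longrightarrow> \<eta> \<le> \<bar>t - y i\<bar>"
proof -
  obtain M where M: "\<And>y j t i. \<lbrakk>y \<in> simplexS n; t \<in> cell y j; i < n\<rbrakk> \<Longrightarrow> val y t \<le> M + K i (t - y i)"
    using val_bounded_above by metis
  obtain \<eta> where \<eta>: "0 < \<eta>" "\<eta> < 1" "\<And>i x. \<lbrakk>i < n; 0 < \<bar>x\<bar>; \<bar>x\<bar> < \<eta>\<rbrakk> \<Longrightarrow> K i x < B - M"
    using kernel_small_near_0 by metis
  have "\<eta> \<le> \<bar>t - y i\<bar>" if "y \<in> simplexS n" "t \<in> cell y j" "B \<le> val y t" "i < n" for y j t i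
  proof (rule ccontr)
    assume "\<not> \<eta> \<le> \<bar>t - y i\<bar>"
    moreover have "t \<noteq> y i" using that by (cases "i < j") (auto simp: cell_def)
    ultimately have "K i (t - y i) < B - M" using \<eta>(3)[of i "t - y i"] that by auto
    then show False using M[OF that(1,2,4)] that(3) by linarith
  qed
  then show thesis using that \<eta> by blast
qed

text \<open>A near-maximal point \<open>t\<close> for \<open>y\<close> keeps its distance from the
  nodes of \<open>y\<close>, so it lies in the corresponding cell of every nearby \<open>y'\<close>,
  and at fixed \<open>t\<close> the kernels are Lipschitz. Only \<open>y\<close> is assumed to have
  a nonempty cell, so the lemma also puts nearby points into \<open>Y\<close>.\<close>

lemma m_lower_lipschitz:
  assumes "0 < \<rho>"
  obtains \<eta> L where "0 < \<eta>" "0 \<le> L"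
    "\<And>y y' j. \<lbrakk>y \<in> simplexS n; y' \<in> simplexS n; j \<le> n; \<And>i. i < n \<Longrightarrow> \<rho> \<le> y i \<and> y i \<le> 1 - \<rho>;
        \<And>i. i < n \<Longrightarrow> \<bar>y i - y' i\<bar> < \<eta>; cell y j \<noteq> {}; B \<le> m y j\<rbrakk>
      \<Longrightarrow> cell y' j \<noteq> {} \<and> m y j - L * (\<Sum>i<n. \<bar>y i - y' i\<bar>) \<le> m y' j"
proof -
  obtain \<eta>0 where \<eta>0: "0 < \<eta>0" "\<eta>0 < 1"
    "\<And>y j t i. \<lbrakk>y \<in> simplexS n; t \<in> cell y j; B - 1 \<le> val y t; i < n\<rbrakk> \<Longrightarrow> \<eta>0 \<le> \<bar>t - y i\<bar>"
    using cell_separated[of "B - 1"] by metis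
  \<comment> \<open>Nodes moved by less than \<open>\<eta>\<close> stay at least
    \<open>\<eta>\<close> away from \<open>t\<close>, from 0 and from 1, so all kernel arguments
    remain in the range of the Lipschitz bound.\<close>
  define \<eta> where "\<eta> = min (\<eta>0 / 2) (\<rho> / 2)"
  have \<eta>: "0 < \<eta>" "2 * \<eta> \<le> \<eta>0" "2 * \<eta> \<le> \<rho>" using \<eta>0 assms by (auto simp: \<eta>_def)
  obtain L where L: "0 \<le> L"
    "\<And>i x y. \<lbrakk>i < n; x \<in> {\<eta>..1-\<eta>} \<and> y \<in> {\<eta>..1-\<eta>} \<or> x \<in> {\<eta>-1..-\<eta>} \<and> y \<in> {\<eta>-1..-\<eta>}\<rbrakk>
       \<Longrightarrow> \<bar>K i x - K i y\<bar> \<le> L * \<bar>x - y\<bar>"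
    using kernel_lipschitz[OF \<eta>(1)] by metis
  have "cell y' j \<noteq> {} \<and> m y j - L * (\<Sum>i<n. \<bar>y i - y' i\<bar>) \<le> m y' j"
    if y: "y \<in> simplexS n" "y' \<in> simplexS n" and j: "j \<le> n"
      and \<rho>: "\<And>i. i < n \<Longrightarrow> \<rho> \<le> y i \<and> y i \<le> 1 - \<rho>"
      and cl: "\<And>i. i < n \<Longrightarrow> \<bar>y i - y' i\<bar> < \<eta>" and ne: "cell y j \<noteq> {}" and B: "B \<le> m y j" for y y' j
  proof -
    have key: "t \<in> cell y' j \<and> val y t - L * (\<Sum>i<n. \<bar>y i - y' i\<bar>) \<le> val y' t"
      if t: "t \<in> cell y j" "B - 1 \<le> val y t" for t
    proof
      have t01: "0 \<le> t" "t \<le> 1" using t by (auto simp: cell_def)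
      have sep: "\<eta>0 \<le> \<bar>t - y i\<bar>" if "i < n" for i using \<eta>0(3) y t that by blast
      have side: "(i < j \<longrightarrow> y i < t) \<and> (j \<le> i \<longrightarrow> t < y i)" if "i < n" for i
        using t that by (auto simp: cell_def)
      have "(i < j \<longrightarrow> y' i < t) \<and> (j \<le> i \<longrightarrow> t < y' i)" if "i < n" for i
        using sep[OF that] side[OF that] cl[OF that] \<eta> by auto
      then show "t \<in> cell y' j" using t by (auto simp: cell_def)
      have "\<bar>K i (t - y i) - K i (t - y' i)\<bar> \<le> L * \<bar>y i - y' i\<bar>" if "i < n" for i
      proof -
        have "t - y i \<in> {\<eta>..1-\<eta>} \<and> t - y' i \<in> {\<eta>..1-\<eta>} \<or> t - y i \<in> {\<eta>-1..-\<eta>} \<and> t - y' i \<in> {\<eta>-1..-\<eta>}"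
        proof (cases "i < j")
          case True
          then have "t - y i \<in> {\<eta>..1-\<eta>} \<and> t - y' i \<in> {\<eta>..1-\<eta>}"
            using sep[OF that] side[OF that] cl[OF that] \<rho>[OF that] \<eta> t01 by auto
          then show ?thesis ..
        next
          case False
          then have "t - y i \<in> {\<eta>-1..-\<eta>} \<and> t - y' i \<in> {\<eta>-1..-\<eta>}"
            using sep[OF that] side[OF that] cl[OF that] \<rho>[OF that] \<eta> t01 by auto
          then show ?thesis ..
        qed
        from L(2)[OF that this] show ?thesis by (simp add: abs_minus_commute)
      qed
      then have "(\<Sum>i<n. K i (t - y i) - K i (t - y' i)) \<le> (\<Sum>i<n. L * \<bar>y i - y' i\<bar>)"
        by (intro sum_mono) (auto simp: abs_le_iff)
      then show "val y t - L * (\<Sum>i<n. \<bar>y i - y' i\<bar>) \<le> val y' t"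
        by (simp add: val_def sum_subtractf sum_distrib_left)
    qed
    \<comment> \<open>Errors \<open>e \<le> 1\<close> keep the value above \<open>B - 1\<close>, the
      level for which \<open>\<eta>0\<close> was chosen; afterwards \<open>e\<close> tends to
      0.\<close>
    have near: "cell y' j \<noteq> {} \<and> m y j - e - L * (\<Sum>i<n. \<bar>y i - y' i\<bar>) \<le> m y' j" if e: "0 < e" "e \<le> 1" for e
    proof -
      obtain t where t: "t \<in> cell y j" "m y j - e < val y t"
        using m_near[OF y(1) j ne, of "m y j - e"] e by auto
      have "B - 1 \<le> val y t" using t B e by linarith
      from key[OF t(1) this] have "t \<in> cell y' j" "val y t - L * (\<Sum>i<n. \<bar>y i - y' i\<bar>) \<le> val y' t" by auto
      then show ?thesis using m_upper[OF y(2) j, of t] t by auto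
    qed
    have "m y j - L * (\<Sum>i<n. \<bar>y i - y' i\<bar>) \<le> m y' j + e" if "0 < e" for e
      using near[of "min e 1"] that by auto
    then have "m y j - L * (\<Sum>i<n. \<bar>y i - y' i\<bar>) \<le> m y' j" by (rule field_le_epsilon)
    then show ?thesis using near[of 1] by simp
  qed
  then show thesis by (rule that[OF \<eta>(1) L(1)])
qed

text \<open>A value of at least \<open>B\<close> bounds \<open>J\<close> from below at that point,
  whereas \<open>J\<close> is and tends to \<open>-\<infinity>\<close> at one end of
  \<open>[0,1]\<close>. This keeps \<open>s\<close> away from 0 or \<open>t\<close> away from 1,
  uniformly in \<open>y\<close> and \<open>y'\<close>.\<close>

lemma extremal_cells_not_both_ends:
  obtains \<delta> where "0 < \<delta>"
    "\<And>y y' s t. \<lbrakk>y \<in> simplexS n; y' \<in> simplexS n; s \<in> cell y 0; t \<in> cell y' n; B \<le> val y s; B \<le> val y' t\<rbrakk>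
       \<Longrightarrow> t - s \<le> 1 - \<delta>"
proof -
  obtain M where M: "\<And>y j t. \<lbrakk>y \<in> simplexS n; t \<in> cell y j\<rbrakk> \<Longrightarrow> val y t \<le> M + real_of_ereal (J t)"
    using val_bounded_above by metis
  have Jr: "J t = ereal (real_of_ereal (J t))" if "t \<in> cell y j" for y j t
    using J_bounded[of "J t = ereal (real_of_ereal (J t))"] that by (cases "J t") (force simp: cell_def)+
  have JB: "\<not> J t < ereal (B - M)" if "y \<in> simplexS n" "t \<in> cell y j" "B \<le> val y t" for y j t
    using M[OF that(1,2)] that(3) Jr[OF that(2)] by (metis add.commute diff_le_eq less_ereal.simps(1) not_less order_trans)
  from infty show thesis
  proof
    assume J0: "J 0 = -\<infinity> \<and> (J \<longlongrightarrow> -\<infinity>) (at_right 0)"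
    then have "\<forall>\<^sub>F t in at_right 0. J t < ereal (B - M)" by (intro order_tendstoD(2)) auto
    then obtain \<delta> where \<delta>: "0 < \<delta>" "\<And>t. 0 < t \<Longrightarrow> t < \<delta> \<Longrightarrow> J t < ereal (B - M)"
      by (auto simp: eventually_at_right_field)
    show thesis
    proof (rule that[OF \<delta>(1)])
      fix y y' s t
      assume *: "y \<in> simplexS n" "y' \<in> simplexS n" "s \<in> cell y 0" "t \<in> cell y' n" "B \<le> val y s" "B \<le> val y' t"
      have "\<not> J s < ereal (B - M)" using JB * by blast
      moreover have "s \<noteq> 0" "0 \<le> s" "t \<le> 1" using * J0 by (auto simp: cell_def)
      ultimately show "t - s \<le> 1 - \<delta>" using \<delta>(2)[of s] by linarith
    qed
  next
    assume J1: "J 1 = -\<infinity> \<and> (J \<longlongrightarrow> -\<infinity>) (at_left 1)"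
    then have "\<forall>\<^sub>F t in at_left 1. J t < ereal (B - M)" by (intro order_tendstoD(2)) auto
    then obtain b where b: "b < 1" "\<And>t. b < t \<Longrightarrow> t < 1 \<Longrightarrow> J t < ereal (B - M)"
      by (auto simp: eventually_at_left_field)
    show thesis
    proof (rule that[of "1 - b"])
      fix y y' s t
      assume *: "y \<in> simplexS n" "y' \<in> simplexS n" "s \<in> cell y 0" "t \<in> cell y' n" "B \<le> val y s" "B \<le> val y' t"
      have "\<not> J t < ereal (B - M)" using JB * by blast
      moreover have "t \<noteq> 1" "0 \<le> s" "t \<le> 1" using * J1 by (auto simp: cell_def)
      ultimately show "t - s \<le> 1 - (1 - b)" using b(2)[of t] by linarith
    qed (use b in auto)
  qed
qed

section \<open>Kernel differences caused by moving a node\<close>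

text \<open>The four-point inequality with \<open>p = t - v\<close>, \<open>h = v - u\<close>,
  \<open>d = t' - t\<close>; all arguments are negative because \<open>t\<close> and
  \<open>t'\<close> lie left of both node positions.\<close>

lemma difference_mono_left:
  assumes "i < n" "0 \<le> t" "t \<le> t'" "t' < u" "u \<le> v" "v < 1"
  shows "K i (t - v) - K i (t - u) \<le> K i (t' - v) - K i (t' - u)"
  using concave_on_four_points[OF concave_neg[OF assms(1)], of "t - v" "v - u" "t' - t"] assms by simp

lemma difference_mono_right:
  assumes "i < n" "v < t" "t \<le> t'" "t' \<le> 1" "0 < u" "u \<le> v"
  shows "K i (t - v) - K i (t - u) \<le> K i (t' - v) - K i (t' - u)"
  using concave_on_four_points[OF concave_pos[OF assms(1)], of "t - v" "v - u" "t' - t"] assms by simp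

text \<open>Monotonicity \<open>(PM\<^sub>0)\<close> moves the right-hand increment to \<open>(-1,0)\<close>, where strict concavity applies.\<close>

lemma difference_drop_across:
  assumes "0 < \<delta>"
  obtains c where "0 < c"
    "\<And>i s t u v. \<lbrakk>i < n; 0 \<le> s; s < u; u \<le> v; v < t; t \<le> 1; t - s \<le> 1 - \<delta>\<rbrakk>
       \<Longrightarrow> c * (v - u) \<le> (K i (s - v) - K i (s - u)) - (K i (t - v) - K i (t - u))"
proof -
  obtain c where c: "0 < c"
    "\<And>i p h d. \<lbrakk>i < n; - 1 < p; 0 \<le> h; \<delta> \<le> d; p + h + d < 0\<rbrakk>
       \<Longrightarrow> c * h \<le> K i (p + h) + K i (p + d) - K i p - K i (p + h + d)"
    using kernel_uniformly_strict[OF assms] by metis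
  have "c * (v - u) \<le> (K i (s - v) - K i (s - u)) - (K i (t - v) - K i (t - u))"
    if *: "i < n" "0 \<le> s" "s < u" "u \<le> v" "v < t" "t \<le> 1" "t - s \<le> 1 - \<delta>" for i s t u v
  proof -
    have "K i (t - v + (v - u) - 1) - K i (t - v - 1) \<le> K i (t - v + (v - u)) - K i (t - v)"
      by (rule PM_increment[OF concave_neg[OF *(1)] concave_pos[OF *(1)]]) (use * kern in auto)
    then have "K i (t - u - 1) - K i (t - v - 1) \<le> K i (t - u) - K i (t - v)" by simp
    \<comment> \<open>The shift \<open>s - t + 1\<close> is at least \<open>\<delta>\<close> exactly
      because \<open>t - s \<le> 1 - \<delta>\<close>.\<close>
    moreover have "c * (v - u) \<le> K i (t - v - 1 + (v - u)) + K i (t - v - 1 + (s - t + 1)) - K i (t - v - 1)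
        - K i (t - v - 1 + (v - u) + (s - t + 1))"
      by (rule c(2)) (use * in auto)
    then have "c * (v - u) \<le> K i (t - u - 1) + K i (s - v) - K i (t - v - 1) - K i (s - u)"
      by (simp add: algebra_simps)
    ultimately show ?thesis by linarith
  qed
  then show thesis using that c(1) by blast
qed

subsection \<open>Expansiveness\<close>

lemma cell_subset:
  assumes y: "y \<in> simplexS n" "y' \<in> simplexS n" and j: "j \<le> n"
    and "0 < j \<Longrightarrow> y' (j - 1) \<le> y (j - 1)" and "j < n \<Longrightarrow> y j \<le> y' j"
  shows "cell y j \<subseteq> cell y' j"
proof
  fix t assume t: "t \<in> cell y j"
  have "y' i < t" if "i < n" "i < j" for i
  proof -
    have "y' i \<le> y' (j - 1)" using simplexD(3)[OF y(2), of i "j - 1"] that j by auto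
    moreover have "y (j - 1) < t" using t that j by (auto simp: cell_def)
    ultimately show ?thesis using assms(4) that by simp
  qed
  moreover have "t < y' i" if "i < n" "j \<le> i" for i
  proof -
    have "y' j \<le> y' i" using simplexD(3)[OF y(2), of j i] that by auto
    moreover have "t < y j" using t that by (auto simp: cell_def)
    ultimately show ?thesis using assms(5) that by simp
  qed
  ultimately show "t \<in> cell y' j" using t by (auto simp: cell_def)
qed

text \<open>At a positive jump the node bounding the cell on the left, if any, moves left and the
  one on the right moves right, so the cell does not shrink; a negative jump gives the reverse
  inclusion. The near-maximal point is taken in the smaller cell, and the error \<open>2 * e\<close>
  comes from \<open>\<bar>a\<bar> \<le> 2\<close>.\<close>

lemma near_maximum_in_smaller_cell:
  assumes y: "y \<in> Yset n J K" "y' \<in> Yset n J K" and j: "j \<le> n" and e: "0 < e"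
    and s: "\<And>i. s i = (if y i \<le> y' i then 1 else -1 :: real)"
    and jump: "sign_jump n s j \<noteq> 0"
  obtains t where "t \<in> cell y j" "t \<in> cell y' j" "m y j - e < val y t \<or> m y' j - e < val y' t"
    "sign_jump n s j * (val y' t - val y t) - 2 * e \<le> sign_jump n s j * (m y' j - m y j)"
proof -
  define a where "a = sign_jump n s j"
  have abs: "\<bar>a\<bar> \<le> 2" using s by (auto simp: a_def sign_jump_def)
  have S: "y \<in> simplexS n" "y' \<in> simplexS n" "cell y j \<noteq> {}" "cell y' j \<noteq> {}" using y j by (auto simp: Yset_iff)
  show thesis
  proof (cases "0 < a")
    case True
    have sub: "cell y j \<subseteq> cell y' j"
      by (rule cell_subset[OF S(1,2) j]) (use True s j in \<open>auto simp: a_def sign_jump_def split: if_splits\<close>)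
    obtain t where t: "t \<in> cell y j" "m y j - e < val y t"
      using m_near[OF S(1) j S(3), of "m y j - e"] e by auto
    have "val y' t \<le> m y' j" using m_upper[OF S(2) j] t sub by blast
    then have "val y' t - val y t - e \<le> m y' j - m y j" using t by linarith
    then have "a * (val y' t - val y t - e) \<le> a * (m y' j - m y j)" using True by (intro mult_left_mono) auto
    moreover have "a * e \<le> 2 * e" using abs e by (intro mult_right_mono) auto
    ultimately show thesis using t sub by (intro that[of t]) (auto simp: a_def[symmetric] right_diff_distrib)
  next
    case False
    then have neg: "a < 0" using jump by (simp add: a_def)
    have sub: "cell y' j \<subseteq> cell y j"
      by (rule cell_subset[OF S(2,1) j]) (use neg s j in \<open>auto simp: a_def sign_jump_def split: if_splits\<close>)
    obtain t where t: "t \<in> cell y' j" "m y' j - e < val y' t"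
      using m_near[OF S(2) j S(4), of "m y' j - e"] e by auto
    have "val y t \<le> m y j" using m_upper[OF S(1) j] t sub by blast
    then have "m y' j - m y j \<le> val y' t - val y t + e" using t by linarith
    then have "a * (val y' t - val y t + e) \<le> a * (m y' j - m y j)" using neg by (intro mult_left_mono_neg) auto
    moreover have "- a * e \<le> 2 * e" using abs e by (intro mult_right_mono) auto
    ultimately show thesis using t sub by (intro that[of t]) (auto simp: a_def[symmetric] right_diff_distrib distrib_left)
  qed
qed

text \<open>The constant depends on \<open>B\<close> alone. Injectivity, the Cauchy property of
  preimages and the lower bi-Lipschitz bound all rest on this estimate.\<close>

lemma Phi_expansive:
  obtains c where "0 < c"
    "\<And>y y'. \<lbrakk>y \<in> Yset n J K; y' \<in> Yset n J K; \<And>j. j \<le> n \<Longrightarrow> B \<le> m y j \<and> B \<le> m y' j\<rbrakk>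
       \<Longrightarrow> c * (\<Sum>i<n. \<bar>y' i - y i\<bar>) \<le> (\<Sum>i<n. \<bar>Phi n J K y' i - Phi n J K y i\<bar>)"
proof -
  obtain \<delta> where \<delta>: "0 < \<delta>"
    "\<And>y y' s t. \<lbrakk>y \<in> simplexS n; y' \<in> simplexS n; s \<in> cell y 0; t \<in> cell y' n; B - 1 \<le> val y s; B - 1 \<le> val y' t\<rbrakk>
       \<Longrightarrow> t - s \<le> 1 - \<delta>"
    using extremal_cells_not_both_ends[of "B - 1"] by metis
  obtain c where c: "0 < c"
    "\<And>i s t u v. \<lbrakk>i < n; 0 \<le> s; s < u; u \<le> v; v < t; t \<le> 1; t - s \<le> 1 - \<delta>\<rbrakk>
       \<Longrightarrow> c * (v - u) \<le> (K i (s - v) - K i (s - u)) - (K i (t - v) - K i (t - u))"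
    using difference_drop_across[OF \<delta>(1)] by metis
  show thesis
  proof (rule that[OF c(1)])
    fix y y'
    assume y: "y \<in> Yset n J K" "y' \<in> Yset n J K" and B: "\<And>j. j \<le> n \<Longrightarrow> B \<le> m y j \<and> B \<le> m y' j"
    have S: "y \<in> simplexS n" "y' \<in> simplexS n" using y by (auto simp: Yset_iff)
    define s where "s = (\<lambda>i. if y i \<le> y' i then 1 else -1 :: real)"
    define a where "a = sign_jump n s"
    have approx: "c * (\<Sum>i<n. \<bar>y' i - y i\<bar>) \<le> (\<Sum>i<n. \<bar>Phi n J K y' i - Phi n J K y i\<bar>) + real (Suc n) * (2 * e)"
      if e: "0 < e" "e \<le> 1" for e
    proof -
      have "\<exists>t. a j \<noteq> 0 \<longrightarrow> t \<in> cell y j \<and> t \<in> cell y' j \<and> (m y j - e < val y t \<or> m y' j - e < val y' t) \<and>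
        a j * (val y' t - val y t) - 2 * e \<le> a j * (m y' j - m y j)" if "j \<le> n" for j
        using near_maximum_in_smaller_cell[OF y that e(1), of s] by (auto simp: a_def s_def)
      then obtain t where t: "\<And>j. \<lbrakk>j \<le> n; a j \<noteq> 0\<rbrakk> \<Longrightarrow> t j \<in> cell y j \<and> t j \<in> cell y' j \<and>
          (m y j - e < val y (t j) \<or> m y' j - e < val y' (t j)) \<and>
          a j * (val y' (t j) - val y (t j)) - 2 * e \<le> a j * (m y' j - m y j)"
        by metis
      define g where "g = (\<lambda>i t. K i (t - y' i) - K i (t - y i))"
      \<comment> \<open>Multiplication by the sign turns every node movement into one from the
        minimum to the maximum, so the lemmas for \<open>u \<le> v\<close> apply in both
        directions.\<close>
      have sg: "s i * g i t = K i (t - max (y i) (y' i)) - K i (t - min (y i) (y' i))" for i t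
        by (auto simp: s_def g_def max_def min_def)
      have pos: "t j \<in> {0..1}" "j \<le> i \<Longrightarrow> t j < min (y i) (y' i)" "i < j \<Longrightarrow> max (y i) (y' i) < t j"
        if "i < n" "j \<le> n" "a j \<noteq> 0" for i j
        using t[OF that(2,3)] that(1) by (auto simp: cell_def)
      have order: "t j \<le> t k" if "j < k" "k \<le> n" "a j \<noteq> 0" "a k \<noteq> 0" for j k
      proof -
        have "t j < y j" "y j < t k"
          using pos(2)[of j j] pos(3)[of j k] that by auto
        then show ?thesis by simp
      qed
      have each: "c * \<bar>y' i - y i\<bar> \<le> (\<Sum>j\<le>n. a j * g i (t j))" if i: "i < n" for i
      proof -
        note yi = simplexD(1,2)[OF S(1) i] simplexD(1,2)[OF S(2) i]
        have a0: "a 0 \<noteq> 0" and an: "a n \<noteq> 0"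
          using i by (auto simp: a_def s_def sign_jump_def)
        \<comment> \<open>\<open>t j\<close> is known to be near-maximal for one of
          \<open>y\<close>, \<open>y'\<close> only, possibly a different one for
          \<open>j = 0\<close> and \<open>j = n\<close>; hence the unspecified node system
          \<open>z\<close>.\<close>
        have lower: "\<exists>z\<in>simplexS n. t j \<in> cell z j \<and> B - 1 \<le> val z (t j)" if "j \<le> n" "a j \<noteq> 0" for j
        proof -
          have "B - 1 \<le> val y (t j) \<or> B - 1 \<le> val y' (t j)"
            using t[OF that] B[OF that(1)] e by linarith
          then show ?thesis using t[OF that] S by blast
        qed
        have "t n - t 0 \<le> 1 - \<delta>"
          using lower[of 0] lower[of n] a0 an \<delta>(2)[of _ _ "t 0" "t n"] by blast
        then have "c * (max (y i) (y' i) - min (y i) (y' i)) \<le> s i * g i (t 0) - s i * g i (t n)"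
          unfolding sg by (intro c(2)) (use i pos[OF i, of 0] pos[OF i, of n] a0 an in auto)
        also have "max (y i) (y' i) - min (y i) (y' i) = \<bar>y' i - y i\<bar>" by (simp add: max_def min_def)
        also have "s i * g i (t 0) - s i * g i (t n) = s i * (g i (t 0) - g i (t n))"
          by (simp add: right_diff_distrib)
        \<comment> \<open>Points \<open>t j\<close> with \<open>j \<le> i\<close> lie left of both
          positions of node \<open>i\<close>, those with \<open>j > i\<close> right of both, so
          \<open>s i * g i\<close> is nondecreasing along each group.\<close>
        also have "\<dots> \<le> (\<Sum>j\<le>n. a j * g i (t j))"
          unfolding a_def
        proof (rule sum_sign_jump_ge[OF _ i])
          show "s k = 1 \<or> s k = -1" for k by (simp add: s_def)
          show "s i * g i (t j) \<le> s i * g i (t k)"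
            if "j < k" "k \<le> i" "sign_jump n s j \<noteq> 0" "sign_jump n s k \<noteq> 0" for j k
            unfolding sg using that i yi pos[OF i, of j] pos[OF i, of k] order[of j k]
            by (intro difference_mono_left) (auto simp: a_def)
          show "s i * g i (t j) \<le> s i * g i (t k)"
            if "i < j" "j < k" "k \<le> n" "sign_jump n s j \<noteq> 0" "sign_jump n s k \<noteq> 0" for j k
            unfolding sg using that i yi pos[OF i, of j] pos[OF i, of k] order[of j k]
            by (intro difference_mono_right) (auto simp: a_def)
        qed
        finally show ?thesis .
      qed
      have val_diff: "val y' t - val y t = (\<Sum>i<n. g i t)" for t
        by (simp add: val_def g_def sum_subtractf)
      have "c * (\<Sum>i<n. \<bar>y' i - y i\<bar>) \<le> (\<Sum>i<n. \<Sum>j\<le>n. a j * g i (t j))"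
        unfolding sum_distrib_left by (intro sum_mono each) auto
      also have "\<dots> = (\<Sum>j\<le>n. a j * (val y' (t j) - val y (t j)))"
        unfolding val_diff sum_distrib_left by (rule sum.swap)
      also have "\<dots> \<le> (\<Sum>j\<le>n. a j * (m y' j - m y j) + 2 * e)"
      proof (rule sum_mono)
        fix j assume "j \<in> {..n}"
        then show "a j * (val y' (t j) - val y (t j)) \<le> a j * (m y' j - m y j) + 2 * e"
          using t[of j] e by (cases "a j = 0") auto
      qed
      also have "\<dots> = (\<Sum>j\<le>n. a j * (m y' j - m y j)) + real (Suc n) * (2 * e)"
        by (simp add: sum.distrib)
      \<comment> \<open>For \<open>x j = m y' j - m y j\<close> the difference
        \<open>x i - x (Suc i)\<close> is \<open>Phi n J K y i - Phi n J K y' i\<close>, hence the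
        reversed order of \<open>y\<close> and \<open>y'\<close>.\<close>
      also have "(\<Sum>j\<le>n. a j * (m y' j - m y j)) = (\<Sum>i<n. s i * (Phi n J K y i - Phi n J K y' i))"
        unfolding a_def sum_sign_jump using y by (intro sum.cong) (auto simp: Phi_eq)
      also have "\<dots> \<le> (\<Sum>i<n. \<bar>Phi n J K y' i - Phi n J K y i\<bar>)"
        by (intro sum_mono) (auto simp: s_def)
      finally show ?thesis by simp
    qed
    show "c * (\<Sum>i<n. \<bar>y' i - y i\<bar>) \<le> (\<Sum>i<n. \<bar>Phi n J K y' i - Phi n J K y i\<bar>)"
    proof (rule field_le_epsilon)
      fix \<epsilon> :: real assume "0 < \<epsilon>"
      define e where "e = min 1 (\<epsilon> / (2 * real (Suc n)))"
      have "0 < e" "e \<le> 1" using \<open>0 < \<epsilon>\<close> by (auto simp: e_def)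
      moreover have "e \<le> \<epsilon> / (2 * real (Suc n))" by (simp add: e_def)
      then have "real (Suc n) * (2 * e) \<le> \<epsilon>" by (simp add: pos_le_divide_eq algebra_simps)
      ultimately show "c * (\<Sum>i<n. \<bar>y' i - y i\<bar>) \<le> (\<Sum>i<n. \<bar>Phi n J K y' i - Phi n J K y i\<bar>) + \<epsilon>"
        using approx[of e] by linarith
    qed
  qed
qed

subsection \<open>Bounds and local regularity\<close>

text \<open>At most one end of \<open>[0,1]\<close> carries a finite value and it weighs only
  \<open>1/2\<close>, so weight above \<open>n\<close> means at least \<open>n + 1\<close> interior
  points, or \<open>n\<close> of them together with that end.\<close>

lemma finite_field_points:
  obtains T where "finite T" "T \<subseteq> {0..1}" "card T = Suc n" "\<And>t. t \<in> T \<Longrightarrow> J t \<noteq> -\<infinity>" "0 \<notin> T \<or> 1 \<notin> T"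
proof -
  define W where "W = {t\<in>{0..1}. J t \<noteq> -\<infinity>}"
  have W01: "0 \<notin> W \<or> 1 \<notin> W" using infty by (auto simp: W_def)
  have w: "weight W > ereal (real n)" using field by (auto simp: field_function_def W_def)
  have "\<exists>T\<subseteq>W. finite T \<and> card T = Suc n"
  proof (cases "finite (W \<inter> {0<..<1})")
    case False
    then obtain T where "T \<subseteq> W \<inter> {0<..<1}" "finite T" "card T = Suc n"
      using infinite_arbitrarily_large by metis
    then show ?thesis by blast
  next
    case True
    have Weq: "W = (W \<inter> {0<..<1}) \<union> (W \<inter> {0, 1})" by (auto simp: W_def)
    then have fin: "finite W" by (metis True finite.emptyI finite_Int finite_UnI finite_insert)
    have "card W = card (W \<inter> {0<..<1}) + card (W \<inter> {0, 1})"
      by (subst Weq, rule card_Un_disjoint) (use True in auto)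
    moreover have "real (card (W \<inter> {0<..<1})) + (if 0 \<in> W then 1/2 else 0) + (if 1 \<in> W then 1/2 else 0) > real n"
      using w True by (simp add: weight_def)
    ultimately have "Suc n \<le> card W" using W01 by (auto split: if_splits)
    then show ?thesis using fin obtain_subset_with_card_n by metis
  qed
  then obtain T where "T \<subseteq> W" "finite T" "card T = Suc n" by blast
  then show thesis using W01 by (intro that[of T]) (auto simp: W_def)
qed

lemma Yset_nonempty: "Yset n J K \<noteq> {}"
proof -
  obtain T where T: "finite T" "T \<subseteq> {0..1}" "card T = Suc n" "\<And>t. t \<in> T \<Longrightarrow> J t \<noteq> -\<infinity>"
    using finite_field_points by metis
  define l where "l = sorted_list_of_set T"
  have len: "length l = Suc n" and set: "set l = T" using T by (auto simp: l_def)
  have less: "l ! i < l ! j" if "i < j" "j \<le> n" for i j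
    using sorted_wrt_nth_less[OF strict_sorted_list_of_set[of T], of i j] that len by (simp add: l_def)
  have inT: "l ! i \<in> T" if "i \<le> n" for i using that len set by (metis less_Suc_eq_le nth_mem)
  then have l01: "0 \<le> l ! i" "l ! i \<le> 1" if "i \<le> n" for i using T(2) that by (auto simp: subset_iff)
  \<comment> \<open>Nodes at the midpoints of consecutive field points put \<open>l ! j\<close> into
    cell \<open>j\<close>.\<close>
  define y where "y = (\<lambda>i. if i < n then (l ! i + l ! Suc i) / 2 else 0)"
  have bet: "l ! i < y i" "y i < l ! Suc i" if "i < n" for i
    using less[of i "Suc i"] that by (auto simp: y_def)
  have up: "y i < l ! j" if "i < j" "j \<le> n" for i j
    using bet(2)[of i] less[of "Suc i" j] that by (cases "Suc i = j") auto
  have low: "l ! j < y i" if "j \<le> i" "i < n" for i j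
    using bet(1)[of i] less[of j i] that by (cases "i = j") auto
  have yS: "y \<in> simplexS n"
    unfolding simplexS_def
  proof (intro CollectI conjI allI impI)
    show "y i = 0" if "n \<le> i" for i using that by (simp add: y_def)
    show "0 < y i" "y i < 1" if "i < n" for i
      using bet[OF that] l01[of i] l01[of "Suc i"] that by auto
    show "y i < y j" if "i < j \<and> j < n" for i j
      using up[of i j] bet[of j] that by auto
  qed
  have "l ! j \<in> cell y j" if "j \<le> n" for j
    using l01[OF that] T(4)[OF inT[OF that]] up[of _ j] low[of j] that by (auto simp: cell_def)
  then have "y \<in> Yset n J K" using yS by (auto simp: Yset_iff)
  then show ?thesis by blast
qed

lemma cell_cover:
  assumes y: "y \<in> simplexS n" and t: "t \<in> {0..1}" "J t \<noteq> -\<infinity>" "\<And>i. i < n \<Longrightarrow> t \<noteq> y i"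
  obtains j where "j \<le> n" "t \<in> cell y j"
proof -
  \<comment> \<open>The first node to the right of \<open>t\<close>; the value \<open>n\<close>
    stands for none.\<close>
  define j where "j = (LEAST j. j = n \<or> t < y j)"
  have j: "j = n \<or> t < y j" unfolding j_def by (rule LeastI[of _ n]) simp
  have jn: "j \<le> n" unfolding j_def by (rule Least_le) simp
  have "y i < t" if i: "i < j" for i
  proof -
    have "\<not> (i = n \<or> t < y i)" using not_less_Least i unfolding j_def by blast
    then show ?thesis using t(3)[of i] i jn by auto
  qed
  moreover have "t < y i" if "j \<le> i" "i < n" for i
    using j that simplexD(3)[OF y, of j i] by auto
  ultimately have "t \<in> cell y j" using t by (auto simp: cell_def)
  then show thesis using that jn by blast
qed

text \<open>A node \<open>y\<^sub>i\<close> spoils a point \<open>t\<close> if \<open>t - y\<^sub>i\<close> is close to \<open>0\<close> or to \<open>\<plusminus>1\<close>. Since \<open>0\<close> and \<open>1\<close> are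
  not both present, each of the \<open>n\<close> nodes spoils at most one of the \<open>n + 1\<close> points.\<close>

lemma m_max_bounded_below:
  obtains C where "\<And>y. y \<in> simplexS n \<Longrightarrow> \<exists>j\<le>n. C \<le> m y j"
proof -
  obtain T where T: "finite T" "T \<subseteq> {0..1}" "card T = Suc n" "\<And>t. t \<in> T \<Longrightarrow> J t \<noteq> -\<infinity>" "0 \<notin> T \<or> 1 \<notin> T"
    using finite_field_points by metis
  \<comment> \<open>Two points spoiled by the same node would be less than
    \<open>2 * \<delta>\<close> or more than \<open>1 - 2 * \<delta>\<close> apart; half of the
    smaller of \<open>\<bar>t - t'\<bar>\<close> and its complement to 1 excludes both.\<close>
  define gap where "gap = (\<lambda>(t, t'). min \<bar>t - t'\<bar> (1 - \<bar>t - t'\<bar>) / (2::real))"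
  define P where "P = {(t, t') \<in> T \<times> T. t \<noteq> t'}"
  have "finite P" unfolding P_def by (rule finite_subset[of _ "T \<times> T"]) (use T in auto)
  have gap_pos: "0 < gap p" if "p \<in> P" for p
  proof -
    obtain t t' where p: "p = (t, t')" "t \<in> T" "t' \<in> T" "t \<noteq> t'"
      using \<open>p \<in> P\<close> by (auto simp: P_def)
    then have "0 \<le> t" "t \<le> 1" "0 \<le> t'" "t' \<le> 1" using T by auto
    moreover have "\<not> (t = 0 \<and> t' = 1)" "\<not> (t = 1 \<and> t' = 0)" using p T(5) by auto
    ultimately show ?thesis using p by (auto simp: gap_def)
  qed
  \<comment> \<open>The bound \<open>1/4\<close> keeps one node from being close to both 0 and 1,
    and gives a value when \<open>P\<close> is empty.\<close>
  define \<delta> where "\<delta> = Min (insert (1/4) (gap ` P))"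
  have \<delta>: "0 < \<delta>" "\<delta> \<le> 1/4"
  proof -
    show "0 < \<delta>" unfolding \<delta>_def using \<open>finite P\<close> gap_pos by (subst Min_gr_iff) auto
    show "\<delta> \<le> 1/4" unfolding \<delta>_def using \<open>finite P\<close> by (intro Min_le) auto
  qed
  have dist: "2 * \<delta> \<le> \<bar>t - t'\<bar>" "\<bar>t - t'\<bar> \<le> 1 - 2 * \<delta>" if "t \<in> T" "t' \<in> T" "t \<noteq> t'" for t t'
  proof -
    have "\<delta> \<le> gap (t, t')" unfolding \<delta>_def using \<open>finite P\<close> that by (intro Min_le) (auto simp: P_def)
    then show "2 * \<delta> \<le> \<bar>t - t'\<bar>" "\<bar>t - t'\<bar> \<le> 1 - 2 * \<delta>" by (auto simp: gap_def)
  qed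
  obtain B where B: "\<And>i x. \<lbrakk>i < n; \<delta> \<le> \<bar>x\<bar>; \<bar>x\<bar> \<le> 1 - \<delta>\<rbrakk> \<Longrightarrow> B \<le> K i x"
    using kernel_bounded_below[OF \<delta>(1)] by metis
  define C where "C = Min ((\<lambda>t. real_of_ereal (J t)) ` T) + real n * B"
  have "\<exists>j\<le>n. C \<le> m y j" if y: "y \<in> simplexS n" for y
  proof -
    have "\<exists>t\<in>T. \<forall>i<n. \<delta> \<le> \<bar>t - y i\<bar> \<and> \<bar>t - y i\<bar> \<le> 1 - \<delta>"
    proof (rule ccontr)
      assume "\<not> ?thesis"
      then have "\<forall>t\<in>T. \<exists>i<n. \<bar>t - y i\<bar> < \<delta> \<or> \<bar>t - y i\<bar> > 1 - \<delta>" by (meson not_le)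
      then obtain f where f: "\<And>t. t \<in> T \<Longrightarrow> f t < n \<and> (\<bar>t - y (f t)\<bar> < \<delta> \<or> \<bar>t - y (f t)\<bar> > 1 - \<delta>)" by metis
      have "inj_on f T"
      proof (rule inj_onI, rule ccontr)
        fix t t' assume tt: "t \<in> T" "t' \<in> T" "f t = f t'" "t \<noteq> t'"
        have "0 \<le> t" "t \<le> 1" "0 \<le> t'" "t' \<le> 1" using tt T by auto
        moreover have "0 < y (f t)" "y (f t) < 1" using simplexD[OF y] f tt by auto
        ultimately show False using f[OF tt(1)] f[OF tt(2)] dist[OF tt(1,2,4)] \<delta> unfolding tt(3)[symmetric]
          by (smt (verit))
      qed
      then have "card T \<le> card {..<n}" by (rule card_inj_on_le) (use f in auto)
      then show False using T by simp
    qed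
    then obtain t where t: "t \<in> T" "\<And>i. i < n \<Longrightarrow> \<delta> \<le> \<bar>t - y i\<bar> \<and> \<bar>t - y i\<bar> \<le> 1 - \<delta>" by blast
    have "t \<noteq> y i" if "i < n" for i using t(2)[OF that] \<delta> by auto
    moreover have "t \<in> {0..1}" "J t \<noteq> -\<infinity>" using t(1) T by auto
    ultimately obtain j where j: "j \<le> n" "t \<in> cell y j"
      using cell_cover[OF y, of t] by blast
    have "real n * B \<le> (\<Sum>i<n. K i (t - y i))"
      using sum_bounded_below[of "{..<n}" B "\<lambda>i. K i (t - y i)"] B t(2) by simp
    moreover have "Min ((\<lambda>t. real_of_ereal (J t)) ` T) \<le> real_of_ereal (J t)"
      using T t(1) by (intro Min_le) auto
    ultimately have "C \<le> val y t" by (simp add: C_def val_def)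
    then show ?thesis using m_upper[OF y j] j(1) by force
  qed
  then show thesis by (rule that)
qed

section \<open>Gaps between nodes and local Lipschitz bounds\<close>

text \<open>Each cell contains a near-maximal point at distance at least \<open>\<eta>\<close> from
  \<open>y i\<close>. The point of cell 0 separates \<open>y i\<close> from 0, that of cell
  \<open>n\<close> separates it from 1, and that of cell \<open>k\<close> from
  \<open>y k\<close>.\<close>

lemma m_bounded_below_gaps:
  obtains \<rho> where "0 < \<rho>"
    "\<And>y i. \<lbrakk>y \<in> Yset n J K; \<And>j. j \<le> n \<Longrightarrow> B \<le> m y j; i < n\<rbrakk>
       \<Longrightarrow> \<rho> \<le> y i \<and> y i \<le> 1 - \<rho> \<and> (\<forall>k. i < k \<and> k < n \<longrightarrow> \<rho> \<le> y k - y i)"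
proof -
  obtain \<eta> where \<eta>: "0 < \<eta>"
    "\<And>y j t i. \<lbrakk>y \<in> simplexS n; t \<in> cell y j; B - 1 \<le> val y t; i < n\<rbrakk> \<Longrightarrow> \<eta> \<le> \<bar>t - y i\<bar>"
    using cell_separated[of "B - 1"] by metis
  have "\<eta> \<le> y i \<and> y i \<le> 1 - \<eta> \<and> (\<forall>k. i < k \<and> k < n \<longrightarrow> \<eta> \<le> y k - y i)"
    if y: "y \<in> Yset n J K" and B: "\<And>j. j \<le> n \<Longrightarrow> B \<le> m y j" and i: "i < n" for y i
  proof -
    have S: "y \<in> simplexS n" using y by (simp add: Yset_iff)
    have ex: "\<exists>t\<in>cell y j. \<eta> \<le> \<bar>t - y i\<bar>" if j: "j \<le> n" for j
    proof -
      obtain t where t: "t \<in> cell y j" "B - 1 < val y t"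
        using m_near[OF S j, of "B - 1"] y j B[OF j] by (force simp: Yset_iff)
      then show ?thesis using \<eta>(2)[OF S t(1) _ i] by auto
    qed
    obtain t where "t \<in> cell y 0" "\<eta> \<le> \<bar>t - y i\<bar>" using ex[of 0] by auto
    then have 1: "\<eta> \<le> y i" using i by (auto simp: cell_def)
    obtain t where "t \<in> cell y n" "\<eta> \<le> \<bar>t - y i\<bar>" using ex[of n] by auto
    then have 2: "y i \<le> 1 - \<eta>" using i by (auto simp: cell_def)
    have 3: "\<eta> \<le> y k - y i" if k: "i < k" "k < n" for k
    proof -
      obtain t where "t \<in> cell y k" "\<eta> \<le> \<bar>t - y i\<bar>" using ex[of k] k by auto
      then have "y i < t" "t < y k" "\<eta> \<le> \<bar>t - y i\<bar>" using i k by (auto simp: cell_def)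
      then show ?thesis by simp
    qed
    show ?thesis using 1 2 3 by blast
  qed
  then show thesis using that[OF \<eta>(1)] by blast
qed

lemma simplex_gaps:
  assumes y: "y \<in> simplexS n"
  obtains \<rho> where "0 < \<rho>"
    "\<And>i. i < n \<Longrightarrow> \<rho> \<le> y i \<and> y i \<le> 1 - \<rho> \<and> (\<forall>k. i < k \<and> k < n \<longrightarrow> \<rho> \<le> y k - y i)"
proof -
  have "\<exists>\<rho>>0. \<forall>i<n. \<rho> \<le> y i \<and> y i \<le> 1 - \<rho> \<and> (\<forall>k. i < k \<and> k < n \<longrightarrow> \<rho> \<le> y k - y i)"
  proof (rule uniform_small_constant)
    fix i assume i: "i < n"
    define c where "c = min (min (y i) (1 - y i)) (if Suc i < n then y (Suc i) - y i else 1)"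
    have "0 < c" using simplexD[OF y i] by (auto simp: c_def)
    moreover have "c \<le> y k - y i" if "i < k" "k < n" for k
    proof -
      have "y (Suc i) \<le> y k" using simplexD(3)[OF y, of "Suc i" k] that by auto
      moreover have "Suc i < n" using that by simp
      ultimately show ?thesis by (auto simp: c_def)
    qed
    moreover have "c \<le> y i" "y i \<le> 1 - c" by (auto simp: c_def)
    ultimately show "\<exists>c>0. c \<le> y i \<and> y i \<le> 1 - c \<and> (\<forall>k. i < k \<and> k < n \<longrightarrow> c \<le> y k - y i)" by blast
  qed force
  then show thesis using that by blast
qed

text \<open>\<open>m_lower_lipschitz\<close> is used twice: around \<open>y\<close> it puts nearby
  points into \<open>Y\<close> with suprema above a new bound \<open>B1\<close>; with this bound it
  compares any two nearby points, in both directions.\<close>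

lemma Yset_locally_lipschitz:
  assumes y: "y \<in> Yset n J K"
  obtains r L B where "0 < r" "0 \<le> L"
    "\<And>a. \<lbrakk>\<And>i. n \<le> i \<Longrightarrow> a i = 0; \<And>i. i < n \<Longrightarrow> \<bar>a i - y i\<bar> < r\<rbrakk> \<Longrightarrow> a \<in> Yset n J K \<and> (\<forall>j\<le>n. B \<le> m a j)"
    "\<And>a b j. \<lbrakk>a \<in> Yset n J K; b \<in> Yset n J K; \<And>i. i < n \<Longrightarrow> \<bar>a i - y i\<bar> < r; \<And>i. i < n \<Longrightarrow> \<bar>b i - y i\<bar> < r; j \<le> n\<rbrakk>
      \<Longrightarrow> \<bar>m a j - m b j\<bar> \<le> L * (\<Sum>i<n. \<bar>a i - b i\<bar>)"
proof -
  have S: "y \<in> simplexS n" and ne: "\<And>j. j \<le> n \<Longrightarrow> cell y j \<noteq> {}" using y by (auto simp: Yset_iff)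
  obtain \<rho>' where \<rho>': "0 < \<rho>'"
    "\<And>i. i < n \<Longrightarrow> \<rho>' \<le> y i \<and> y i \<le> 1 - \<rho>' \<and> (\<forall>k. i < k \<and> k < n \<longrightarrow> \<rho>' \<le> y k - y i)"
    using simplex_gaps[OF S] by metis
  \<comment> \<open>Half the margin of \<open>y\<close>, so that nodes moved by less than
    \<open>\<rho>\<close> still have margin \<open>\<rho>\<close>.\<close>
  define \<rho> where "\<rho> = \<rho>' / 2"
  have \<rho>: "0 < \<rho>" "\<rho>' = 2 * \<rho>" using \<rho>' by (auto simp: \<rho>_def)
  define B0 where "B0 = Min (m y ` {..n})"
  have B0: "B0 \<le> m y j" if "j \<le> n" for j using that by (auto simp: B0_def)
  obtain \<eta>1 L1 where 1: "0 < \<eta>1" "0 \<le> L1"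
    "\<And>y y' j. \<lbrakk>y \<in> simplexS n; y' \<in> simplexS n; j \<le> n; \<And>i. i < n \<Longrightarrow> \<rho> \<le> y i \<and> y i \<le> 1 - \<rho>;
        \<And>i. i < n \<Longrightarrow> \<bar>y i - y' i\<bar> < \<eta>1; cell y j \<noteq> {}; B0 \<le> m y j\<rbrakk>
      \<Longrightarrow> cell y' j \<noteq> {} \<and> m y j - L1 * (\<Sum>i<n. \<bar>y i - y' i\<bar>) \<le> m y' j"
    using m_lower_lipschitz[OF \<rho>(1), of B0] by blast
  define B1 where "B1 = B0 - L1 * (real n * \<eta>1)"
  obtain \<eta>2 L2 where 2: "0 < \<eta>2" "0 \<le> L2"
    "\<And>y y' j. \<lbrakk>y \<in> simplexS n; y' \<in> simplexS n; j \<le> n; \<And>i. i < n \<Longrightarrow> \<rho> \<le> y i \<and> y i \<le> 1 - \<rho>;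
        \<And>i. i < n \<Longrightarrow> \<bar>y i - y' i\<bar> < \<eta>2; cell y j \<noteq> {}; B1 \<le> m y j\<rbrakk>
      \<Longrightarrow> cell y' j \<noteq> {} \<and> m y j - L2 * (\<Sum>i<n. \<bar>y i - y' i\<bar>) \<le> m y' j"
    using m_lower_lipschitz[OF \<rho>(1), of B1] by blast
  define r where "r = min \<rho> (min \<eta>1 (\<eta>2 / 2))"
  have r: "0 < r" "r \<le> \<rho>" "r \<le> \<eta>1" "2 * r \<le> \<eta>2" using \<rho> 1 2 by (auto simp: r_def)
  have inner: "\<rho> \<le> a i \<and> a i \<le> 1 - \<rho>" if "\<bar>a i - y i\<bar> < r" "i < n" for a i
    using \<rho>'(2)[OF that(2)] \<rho>(2) r that(1) by auto
  have in_Y: "a \<in> Yset n J K \<and> (\<forall>j\<le>n. B1 \<le> m a j)"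
    if a0: "\<And>i. n \<le> i \<Longrightarrow> a i = 0" and ar: "\<And>i. i < n \<Longrightarrow> \<bar>a i - y i\<bar> < r" for a
  proof -
    have aS: "a \<in> simplexS n"
      unfolding simplexS_def
    proof (intro CollectI conjI allI impI)
      show "a i = 0" if "n \<le> i" for i using that by (rule a0)
      show "0 < a i" "a i < 1" if "i < n" for i
        using inner[of a i, OF ar[OF that] that] \<rho>(1) by auto
      show "a i < a j" if "i < j \<and> j < n" for i j
      proof -
        have "\<rho>' \<le> y j - y i" "i < n" using \<rho>'(2)[of i] that by auto
        then show ?thesis using ar[of i] ar[of j] \<rho> r that by auto
      qed
    qed
    have "cell a j \<noteq> {} \<and> B1 \<le> m a j" if j: "j \<le> n" for j
    proof -
      have step: "cell a j \<noteq> {} \<and> m y j - L1 * (\<Sum>i<n. \<bar>y i - a i\<bar>) \<le> m a j"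
      proof (rule 1(3)[OF S aS j _ _ ne[OF j] B0[OF j]])
        show "\<rho> \<le> y i \<and> y i \<le> 1 - \<rho>" if "i < n" for i using \<rho>'(2)[OF that] \<rho> by auto
        show "\<bar>y i - a i\<bar> < \<eta>1" if "i < n" for i using ar[OF that] r by auto
      qed
      have "(\<Sum>i<n. \<bar>y i - a i\<bar>) \<le> (\<Sum>i<n. \<eta>1)"
      proof (rule sum_mono)
        fix i assume "i \<in> {..<n}"
        then show "\<bar>y i - a i\<bar> \<le> \<eta>1" using ar[of i] r by auto
      qed
      then have "L1 * (\<Sum>i<n. \<bar>y i - a i\<bar>) \<le> L1 * (real n * \<eta>1)" using 1(2) by (intro mult_left_mono) auto
      then show ?thesis using step B0[OF j] by (auto simp: B1_def)
    qed
    then show ?thesis using aS by (simp add: Yset_iff)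
  qed
  have lip: "m a j - L2 * (\<Sum>i<n. \<bar>a i - b i\<bar>) \<le> m b j"
    if ab: "a \<in> Yset n J K" "b \<in> Yset n J K" and ar: "\<And>i. i < n \<Longrightarrow> \<bar>a i - y i\<bar> < r"
      and br: "\<And>i. i < n \<Longrightarrow> \<bar>b i - y i\<bar> < r" and j: "j \<le> n" for a b j
  proof -
    have aS: "a \<in> simplexS n" "b \<in> simplexS n" "cell a j \<noteq> {}" using ab j by (auto simp: Yset_iff)
    have "a i = 0" if "n \<le> i" for i using aS that by (simp add: simplexS_def)
    then have "B1 \<le> m a j" using in_Y[of a] ar j by blast
    moreover have "\<bar>a i - b i\<bar> < \<eta>2" if "i < n" for i using ar[OF that] br[OF that] r by linarith
    ultimately show ?thesis using 2(3)[OF aS(1,2) j] inner ar aS(3) by blast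
  qed
  show thesis
  proof (rule that[OF r(1) 2(2) in_Y])
    fix a b j
    assume ab: "a \<in> Yset n J K" "b \<in> Yset n J K" and ar: "\<And>i. i < n \<Longrightarrow> \<bar>a i - y i\<bar> < r"
      and br: "\<And>i. i < n \<Longrightarrow> \<bar>b i - y i\<bar> < r" and j: "j \<le> n"
    have "m a j - L2 * (\<Sum>i<n. \<bar>a i - b i\<bar>) \<le> m b j" by (rule lip[OF ab ar br j])
    moreover have "m b j - L2 * (\<Sum>i<n. \<bar>b i - a i\<bar>) \<le> m a j" by (rule lip[OF ab(2,1) br ar j])
    moreover have "(\<Sum>i<n. \<bar>b i - a i\<bar>) = (\<Sum>i<n. \<bar>a i - b i\<bar>)" by (simp add: abs_minus_commute)
    ultimately show "\<bar>m a j - m b j\<bar> \<le> L2 * (\<Sum>i<n. \<bar>a i - b i\<bar>)" by auto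
  qed
qed

subsection \<open>The homeomorphism\<close>

lemma Phi_locally_lipschitz:
  assumes y: "y \<in> Yset n J K"
  obtains r L B where "0 < r" "0 \<le> L"
    "\<And>a. \<lbrakk>\<And>i. n \<le> i \<Longrightarrow> a i = 0; \<And>i. i < n \<Longrightarrow> \<bar>a i - y i\<bar> < r\<rbrakk> \<Longrightarrow> a \<in> Yset n J K \<and> (\<forall>j\<le>n. B \<le> m a j)"
    "\<And>a b i. \<lbrakk>a \<in> Yset n J K; b \<in> Yset n J K; \<And>i. i < n \<Longrightarrow> \<bar>a i - y i\<bar> < r; \<And>i. i < n \<Longrightarrow> \<bar>b i - y i\<bar> < r\<rbrakk>
      \<Longrightarrow> \<bar>Phi n J K a i - Phi n J K b i\<bar> \<le> L * (\<Sum>i<n. \<bar>a i - b i\<bar>)"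
proof -
  obtain r L B where r: "0 < r" "0 \<le> L"
    "\<And>a. \<lbrakk>\<And>i. n \<le> i \<Longrightarrow> a i = 0; \<And>i. i < n \<Longrightarrow> \<bar>a i - y i\<bar> < r\<rbrakk> \<Longrightarrow> a \<in> Yset n J K \<and> (\<forall>j\<le>n. B \<le> m a j)"
    "\<And>a b j. \<lbrakk>a \<in> Yset n J K; b \<in> Yset n J K; \<And>i. i < n \<Longrightarrow> \<bar>a i - y i\<bar> < r; \<And>i. i < n \<Longrightarrow> \<bar>b i - y i\<bar> < r; j \<le> n\<rbrakk>
      \<Longrightarrow> \<bar>m a j - m b j\<bar> \<le> L * (\<Sum>i<n. \<bar>a i - b i\<bar>)"
    using Yset_locally_lipschitz[OF y] by blast
  have *: "\<bar>Phi n J K a i - Phi n J K b i\<bar> \<le> 2 * L * (\<Sum>i<n. \<bar>a i - b i\<bar>)"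
    if ab: "a \<in> Yset n J K" "b \<in> Yset n J K" "\<And>i. i < n \<Longrightarrow> \<bar>a i - y i\<bar> < r" "\<And>i. i < n \<Longrightarrow> \<bar>b i - y i\<bar> < r" for a b i
  proof (cases "i < n")
    case True
    have "\<bar>m a j - m b j\<bar> \<le> L * (\<Sum>i<n. \<bar>a i - b i\<bar>)" if "j \<le> n" for j
      by (rule r(4)[OF ab that])
    from this[of i] this[of "Suc i"] show ?thesis using True ab(1,2) by (simp add: Phi_eq)
  next
    case False
    have "0 \<le> 2 * L * (\<Sum>i<n. \<bar>a i - b i\<bar>)" using r(2) by (intro mult_nonneg_nonneg sum_nonneg) auto
    then show ?thesis using False by (simp add: Phi_def)
  qed
  show thesis by (rule that[OF r(1) _ r(3) *]) (use r(2) in auto)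
qed

text \<open>An arbitrary filter serves both uses: \<open>at y within Yset n J K\<close> for
  continuity and \<open>sequentially\<close> for closedness of the image.\<close>

lemma Phi_tendsto:
  assumes y: "y \<in> Yset n J K"
    and u: "\<forall>\<^sub>F k in F. u k \<in> Yset n J K" and lim: "\<And>i. i < n \<Longrightarrow> ((\<lambda>k. u k i) \<longlongrightarrow> y i) F"
  shows "((\<lambda>k. Phi n J K (u k) i) \<longlongrightarrow> Phi n J K y i) F"
proof -
  obtain r L B where r: "0 < r" "0 \<le> L"
    "\<And>a. \<lbrakk>\<And>i. n \<le> i \<Longrightarrow> a i = 0; \<And>i. i < n \<Longrightarrow> \<bar>a i - y i\<bar> < r\<rbrakk> \<Longrightarrow> a \<in> Yset n J K \<and> (\<forall>j\<le>n. B \<le> m a j)"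
    "\<And>a b i. \<lbrakk>a \<in> Yset n J K; b \<in> Yset n J K; \<And>i. i < n \<Longrightarrow> \<bar>a i - y i\<bar> < r; \<And>i. i < n \<Longrightarrow> \<bar>b i - y i\<bar> < r\<rbrakk>
      \<Longrightarrow> \<bar>Phi n J K a i - Phi n J K b i\<bar> \<le> L * (\<Sum>i<n. \<bar>a i - b i\<bar>)"
    using Phi_locally_lipschitz[OF y] by blast
  have "\<forall>\<^sub>F k in F. \<forall>i\<in>{..<n}. \<bar>u k i - y i\<bar> < r"
  proof (rule eventually_ball_finite)
    show "\<forall>i\<in>{..<n}. \<forall>\<^sub>F k in F. \<bar>u k i - y i\<bar> < r"
      using tendstoD[OF lim r(1)] by (auto simp: dist_real_def)
  qed simp
  with u have "\<forall>\<^sub>F k in F. norm (Phi n J K (u k) i - Phi n J K y i) \<le> L * (\<Sum>i<n. \<bar>u k i - y i\<bar>)"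
  proof eventually_elim
    case (elim k)
    show ?case using r(4)[OF elim(1) y, of i] elim(2) r(1) by simp
  qed
  moreover have "((\<lambda>k. L * (\<Sum>i<n. \<bar>u k i - y i\<bar>)) \<longlongrightarrow> L * (\<Sum>i<n. \<bar>y i - y i\<bar>)) F"
    by (intro tendsto_intros lim) auto
  then have "((\<lambda>k. L * (\<Sum>i<n. \<bar>u k i - y i\<bar>)) \<longlongrightarrow> 0) F" by simp
  ultimately have "((\<lambda>k. Phi n J K (u k) i - Phi n J K y i) \<longlongrightarrow> 0) F"
    by (rule Lim_null_comparison)
  then show ?thesis by (simp add: LIM_zero_iff)
qed

lemma Yset_subset: "Yset n J K \<subseteq> topspace (Euclidean_space n)"
  by (auto simp: Yset_def simplexS_def topspace_Euclidean_space)

lemma openin_Yset: "openin (Euclidean_space n) (Yset n J K)"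
proof (subst openin_subopen, rule ballI)
  fix y assume y: "y \<in> Yset n J K"
  obtain r L B where r: "0 < r" "0 \<le> L"
    "\<And>a. \<lbrakk>\<And>i. n \<le> i \<Longrightarrow> a i = 0; \<And>i. i < n \<Longrightarrow> \<bar>a i - y i\<bar> < r\<rbrakk> \<Longrightarrow> a \<in> Yset n J K \<and> (\<forall>j\<le>n. B \<le> m a j)"
    "\<And>a b i. \<lbrakk>a \<in> Yset n J K; b \<in> Yset n J K; \<And>i. i < n \<Longrightarrow> \<bar>a i - y i\<bar> < r; \<And>i. i < n \<Longrightarrow> \<bar>b i - y i\<bar> < r\<rbrakk>
      \<Longrightarrow> \<bar>Phi n J K a i - Phi n J K b i\<bar> \<le> L * (\<Sum>i<n. \<bar>a i - b i\<bar>)"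
    using Phi_locally_lipschitz[OF y] by blast
  define U where "U = (\<Inter>i\<in>{..<n}. (\<lambda>a::nat \<Rightarrow> real. a i) -` ball (y i) r)"
  have "open U" unfolding U_def by (intro open_INT ballI open_vimage) auto
  then have "openin (Euclidean_space n) (topspace (Euclidean_space n) \<inter> U)"
    unfolding Euclidean_space_def euclidean_product_topology by (simp add: openin_open_Int)
  moreover have "y \<in> topspace (Euclidean_space n) \<inter> U" using y Yset_subset r(1) by (auto simp: U_def)
  moreover have "topspace (Euclidean_space n) \<inter> U \<subseteq> Yset n J K"
    using r(3) by (auto simp: U_def topspace_Euclidean_space dist_real_def abs_minus_commute)
  ultimately show "\<exists>T. openin (Euclidean_space n) T \<and> y \<in> T \<and> T \<subseteq> Yset n J K" by blast
qed

lemma continuous_map_Phi: "continuous_map (subtopology (Euclidean_space n) (Yset n J K)) (Euclidean_space n) (Phi n J K)"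
proof -
  have top: "topspace (subtopology (Euclidean_space n) (Yset n J K)) = Yset n J K"
    using Yset_subset by auto
  have "continuous_on (Yset n J K) (\<lambda>y. Phi n J K y i)" for i
    unfolding continuous_on_def
  proof
    fix y assume y: "y \<in> Yset n J K"
    show "((\<lambda>y. Phi n J K y i) \<longlongrightarrow> Phi n J K y i) (at y within Yset n J K)"
    proof (rule Phi_tendsto[OF y])
      show "\<forall>\<^sub>F k in at y within Yset n J K. k \<in> Yset n J K" by (simp add: eventually_at_filter)
      show "((\<lambda>k. k i) \<longlongrightarrow> y i) (at y within Yset n J K)" for i
        using continuous_on_subset[OF continuous_on_product_coordinates[of i] subset_UNIV] y
        unfolding continuous_on_def by blast
    qed
  qed
  then have "continuous_on (Yset n J K) (Phi n J K)"
    by (rule continuous_on_coordinatewise_then_product)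
  then show ?thesis
    unfolding cm_Euclidean_space_iff_continuous_on top
    by (auto simp: topspace_Euclidean_space Phi_def)
qed

lemma inj_on_Phi: "inj_on (Phi n J K) (Yset n J K)"
proof (rule inj_onI)
  fix y y' assume y: "y \<in> Yset n J K" "y' \<in> Yset n J K" and eq: "Phi n J K y = Phi n J K y'"
  define B where "B = Min (m y ` {..n} \<union> m y' ` {..n})"
  have B: "B \<le> m y j \<and> B \<le> m y' j" if "j \<le> n" for j
    unfolding B_def using that by (auto intro!: Min_le)
  obtain c where c: "0 < c"
    "\<And>y y'. \<lbrakk>y \<in> Yset n J K; y' \<in> Yset n J K; \<And>j. j \<le> n \<Longrightarrow> B \<le> m y j \<and> B \<le> m y' j\<rbrakk>
       \<Longrightarrow> c * (\<Sum>i<n. \<bar>y' i - y i\<bar>) \<le> (\<Sum>i<n. \<bar>Phi n J K y' i - Phi n J K y i\<bar>)"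
    using Phi_expansive[of B] by blast
  have "c * (\<Sum>i<n. \<bar>y' i - y i\<bar>) \<le> (\<Sum>i<n. \<bar>Phi n J K y' i - Phi n J K y i\<bar>)"
    by (rule c(2)[OF y B])
  with c(1) have "(\<Sum>i<n. \<bar>y' i - y i\<bar>) \<le> 0" using eq by (simp add: mult_le_0_iff)
  moreover have "0 \<le> (\<Sum>i<n. \<bar>y' i - y i\<bar>)" by (intro sum_nonneg) auto
  ultimately have "(\<Sum>i<n. \<bar>y' i - y i\<bar>) = 0" by simp
  then have "\<forall>i\<in>{..<n}. \<bar>y' i - y i\<bar> = 0" by (subst (asm) sum_nonneg_eq_0_iff) auto
  moreover have "y i = 0" "y' i = 0" if "\<not> i < n" for i
    using y that by (auto simp: Yset_def simplexS_def)
  ultimately show "y = y'" by (intro ext) (metis abs_eq_0 eq_iff_diff_eq_0 lessThan_iff)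
qed

text \<open>Consecutive \<open>m y j\<close> differ by at most \<open>A\<close>, so each is within
  \<open>n * \<bar>A\<bar>\<close> of \<open>m y 0\<close>; one of them is at least
  \<open>C\<close>, and the way through \<open>m y 0\<close> doubles the loss.\<close>

lemma m_bounded_below_of_Phi_bounded:
  obtains B where "\<And>y j. \<lbrakk>y \<in> Yset n J K; \<And>i. i < n \<Longrightarrow> \<bar>Phi n J K y i\<bar> \<le> A; j \<le> n\<rbrakk> \<Longrightarrow> B \<le> m y j"
proof -
  obtain C where C: "\<And>y. y \<in> simplexS n \<Longrightarrow> \<exists>j\<le>n. C \<le> m y j" using m_max_bounded_below by metis
  have "C - 2 * (real n * \<bar>A\<bar>) \<le> m y j"
    if y: "y \<in> Yset n J K" and A: "\<And>i. i < n \<Longrightarrow> \<bar>Phi n J K y i\<bar> \<le> A" and j: "j \<le> n" for y j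
  proof -
    have d: "\<bar>m y k - m y 0\<bar> \<le> real k * \<bar>A\<bar>" if "k \<le> n" for k
      using that
    proof (induction k)
      case (Suc k)
      have "\<bar>m y (Suc k) - m y k\<bar> \<le> A" using A[of k] Phi_eq[OF y, of k] Suc by simp
      then show ?case using Suc by (simp add: algebra_simps)
    qed simp
    have d': "\<bar>m y k - m y 0\<bar> \<le> real n * \<bar>A\<bar>" if "k \<le> n" for k
      using d[OF that] mult_right_mono[of "real k" "real n" "\<bar>A\<bar>"] that by simp
    obtain k where "k \<le> n" "C \<le> m y k" using C y by (auto simp: Yset_iff)
    then show ?thesis using d'[of k] d'[OF j] by linarith
  qed
  then show thesis using that by blast
qed

section \<open>Closedness of the image and surjectivity\<close>

text \<open>A convergent sequence of images is bounded, so the suprema of its preimages have a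
  common lower bound \<open>B\<close>. Expansiveness for this \<open>B\<close> makes the preimages
  Cauchy, and it remains to see that their limit lies in \<open>Y\<close>.\<close>

lemma closedin_Phi_image: "closedin (Euclidean_space n) (Phi n J K ` Yset n J K)"
  unfolding closedin_Euclidean_space_iff
proof
  show "Phi n J K ` Yset n J K \<subseteq> topspace (Euclidean_space n)"
    by (auto simp: topspace_Euclidean_space Phi_def)
  show "closed (Phi n J K ` Yset n J K)"
    unfolding closed_sequential_limits
  proof (intro allI impI, elim conjE)
    fix x l assume x: "\<forall>k. x k \<in> Phi n J K ` Yset n J K" and xl: "x \<longlonglongrightarrow> l"
    have "\<forall>k. \<exists>y. y \<in> Yset n J K \<and> x k = Phi n J K y" using x by blast
    then obtain y where y: "\<And>k. y k \<in> Yset n J K" and xy: "\<And>k. x k = Phi n J K (y k)"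
      by metis
    have lim: "(\<lambda>k. x k i) \<longlonglongrightarrow> l i" for i
      using continuous_on_tendsto_compose[OF continuous_on_product_coordinates[of i] xl] by simp
    have "\<exists>A\<ge>0. \<forall>i<n. \<forall>k. \<bar>x k i\<bar> \<le> A"
    proof (rule uniform_large_constant)
      fix i
      have "Bseq (\<lambda>k. x k i)" using lim convergentI convergent_imp_Bseq by blast
      then show "\<exists>A. \<forall>k. \<bar>x k i\<bar> \<le> A" by (auto simp: Bseq_def)
    qed (meson order_trans)
    then obtain A where A: "\<And>k i. i < n \<Longrightarrow> \<bar>Phi n J K (y k) i\<bar> \<le> A" unfolding xy by blast
    obtain B where "\<And>y j. \<lbrakk>y \<in> Yset n J K; \<And>i. i < n \<Longrightarrow> \<bar>Phi n J K y i\<bar> \<le> A; j \<le> n\<rbrakk> \<Longrightarrow> B \<le> m y j"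
      using m_bounded_below_of_Phi_bounded[of A] by blast
    then have B: "B \<le> m (y k) j" if "j \<le> n" for k j using y A that by blast
    obtain c where c: "0 < c"
      "\<And>y y'. \<lbrakk>y \<in> Yset n J K; y' \<in> Yset n J K; \<And>j. j \<le> n \<Longrightarrow> B \<le> m y j \<and> B \<le> m y' j\<rbrakk>
         \<Longrightarrow> c * (\<Sum>i<n. \<bar>y' i - y i\<bar>) \<le> (\<Sum>i<n. \<bar>Phi n J K y' i - Phi n J K y i\<bar>)"
      using Phi_expansive[of B] by blast
    define S where "S = (\<lambda>k. \<Sum>i<n. \<bar>x k i - l i\<bar>)"
    have "S \<longlonglongrightarrow> (\<Sum>i<n. \<bar>l i - l i\<bar>)" unfolding S_def by (intro tendsto_intros lim)
    then have S0: "S \<longlonglongrightarrow> 0" by simp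
    have est: "\<bar>y k i - y k' i\<bar> \<le> (S k + S k') / c" if i: "i < n" for i k k'
    proof -
      have "c * \<bar>y k i - y k' i\<bar> \<le> c * (\<Sum>i<n. \<bar>y k i - y k' i\<bar>)"
        using c(1) i by (intro mult_left_mono member_le_sum) auto
      also have "\<dots> \<le> (\<Sum>i<n. \<bar>x k i - x k' i\<bar>)" unfolding xy by (rule c(2)) (use y B in auto)
      also have "\<dots> \<le> (\<Sum>i<n. \<bar>x k i - l i\<bar> + \<bar>x k' i - l i\<bar>)" by (intro sum_mono) auto
      also have "\<dots> = S k + S k'" by (simp add: S_def sum.distrib)
      finally show ?thesis using c(1) by (simp add: pos_le_divide_eq mult.commute)
    qed
    have "Cauchy (\<lambda>k. y k i)" if i: "i < n" for i
    proof (rule CauchyI)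
      fix e :: real assume "0 < e"
      then have "\<forall>\<^sub>F k in sequentially. S k < c * e / 2"
        using c(1) by (intro order_tendstoD(2)[OF S0]) simp
      then obtain N where N: "\<And>k. N \<le> k \<Longrightarrow> S k < c * e / 2" by (auto simp: eventually_sequentially)
      have "norm (y k i - y k' i) < e" if "N \<le> k" "N \<le> k'" for k k'
      proof -
        have "S k + S k' < e * c" using N[OF that(1)] N[OF that(2)] by (simp add: mult.commute)
        then have "(S k + S k') / c < e" using c(1) by (simp add: pos_divide_less_eq)
        then show ?thesis using est[OF i, of k k'] by simp
      qed
      then show "\<exists>N. \<forall>k\<ge>N. \<forall>k'\<ge>N. norm (y k i - y k' i) < e" by blast
    qed
    then have "\<forall>i. \<exists>z. i < n \<longrightarrow> (\<lambda>k. y k i) \<longlonglongrightarrow> z" by (meson Cauchy_convergent_iff convergent_def)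
    then obtain z0 where z0: "\<And>i. i < n \<Longrightarrow> (\<lambda>k. y k i) \<longlonglongrightarrow> z0 i" by metis
    define z where "z = (\<lambda>i. if i < n then z0 i else 0)"
    have z: "(\<lambda>k. y k i) \<longlonglongrightarrow> z i" if "i < n" for i using z0[OF that] that by (simp add: z_def)
    \<comment> \<open>The gaps are uniform along the sequence, so they survive the limit and keep
      \<open>z\<close> in the open simplex.\<close>
    obtain \<rho> where \<rho>: "0 < \<rho>"
      "\<And>y i. \<lbrakk>y \<in> Yset n J K; \<And>j. j \<le> n \<Longrightarrow> B \<le> m y j; i < n\<rbrakk>
         \<Longrightarrow> \<rho> \<le> y i \<and> y i \<le> 1 - \<rho> \<and> (\<forall>k. i < k \<and> k < n \<longrightarrow> \<rho> \<le> y k - y i)"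
      using m_bounded_below_gaps[of B] by blast
    have gaps: "\<rho> \<le> y k i \<and> y k i \<le> 1 - \<rho> \<and> (\<forall>j. i < j \<and> j < n \<longrightarrow> \<rho> \<le> y k j - y k i)" if "i < n" for k i
      using \<rho>(2)[OF y B that] by blast
    have zS: "z \<in> simplexS n"
      unfolding simplexS_def
    proof (intro CollectI conjI allI impI)
      show "z i = 0" if "n \<le> i" for i using that by (simp add: z_def)
      show "0 < z i" if "i < n" for i
        using LIMSEQ_le_const[OF z[OF that], of \<rho>] gaps[OF that] \<rho>(1) by force
      show "z i < 1" if "i < n" for i
        using LIMSEQ_le_const2[OF z[OF that], of "1 - \<rho>"] gaps[OF that] \<rho>(1) by force
      show "z i < z j" if "i < j \<and> j < n" for i j
      proof -
        have ij: "i < n" "j < n" using that by auto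
        have "\<rho> \<le> z j - z i"
          using LIMSEQ_le_const[OF tendsto_diff[OF z[OF ij(2)] z[OF ij(1)]], of \<rho>] gaps[OF ij(1)] that by blast
        then show ?thesis using \<rho>(1) by simp
      qed
    qed
    obtain \<eta> L where \<eta>: "0 < \<eta>" "0 \<le> L"
      "\<And>y y' j. \<lbrakk>y \<in> simplexS n; y' \<in> simplexS n; j \<le> n; \<And>i. i < n \<Longrightarrow> \<rho> \<le> y i \<and> y i \<le> 1 - \<rho>;
          \<And>i. i < n \<Longrightarrow> \<bar>y i - y' i\<bar> < \<eta>; cell y j \<noteq> {}; B \<le> m y j\<rbrakk>
        \<Longrightarrow> cell y' j \<noteq> {} \<and> m y j - L * (\<Sum>i<n. \<bar>y i - y' i\<bar>) \<le> m y' j"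
      using m_lower_lipschitz[OF \<rho>(1), of B] by blast
    have "\<forall>\<^sub>F k in sequentially. \<forall>i\<in>{..<n}. \<bar>y k i - z i\<bar> < \<eta>"
    proof (rule eventually_ball_finite)
      show "\<forall>i\<in>{..<n}. \<forall>\<^sub>F k in sequentially. \<bar>y k i - z i\<bar> < \<eta>"
        using tendstoD[OF z \<eta>(1)] by (auto simp: dist_real_def)
    qed simp
    then obtain k where k: "\<And>i. i < n \<Longrightarrow> \<bar>y k i - z i\<bar> < \<eta>"
      unfolding eventually_sequentially by auto
    \<comment> \<open>\<open>\<eta>\<close> is uniform for all \<open>y\<close> with bound
      \<open>B\<close> and margin \<open>\<rho>\<close>, so one term \<open>y k\<close> close enough
      to \<open>z\<close> transfers its nonempty cells.\<close>
    have "cell z j \<noteq> {}" if j: "j \<le> n" for j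
    proof -
      have "y k \<in> simplexS n" "cell (y k) j \<noteq> {}" using y[of k] j by (auto simp: Yset_iff)
      then show ?thesis using \<eta>(3)[OF _ zS j, of "y k"] gaps k B[OF j] by blast
    qed
    then have zY: "z \<in> Yset n J K" using zS by (simp add: Yset_iff)
    have "Phi n J K z i = l i" for i
    proof (rule LIMSEQ_unique[OF _ lim])
      show "(\<lambda>k. x k i) \<longlonglongrightarrow> Phi n J K z i"
        unfolding xy by (rule Phi_tendsto[OF zY]) (use y z in auto)
    qed
    then have "l = Phi n J K z" by auto
    then show "l \<in> Phi n J K ` Yset n J K" using zY by blast
  qed
qed

lemma Phi_surj: "Phi n J K ` Yset n J K = topspace (Euclidean_space n)"
proof -
  have "openin (Euclidean_space n) (Phi n J K ` Yset n J K)"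
    by (rule invariance_of_domain_Euclidean_space[OF openin_Yset continuous_map_Phi inj_on_Phi])
  then show ?thesis
    using connected_Euclidean_space[of n] closedin_Phi_image Yset_nonempty
    unfolding connected_space_clopen_in by blast
qed

lemma homeomorphic_map_Phi:
  "homeomorphic_map (subtopology (Euclidean_space n) (Yset n J K)) (Euclidean_space n) (Phi n J K)"
proof -
  have "embedding_map (subtopology (Euclidean_space n) (Yset n J K)) (Euclidean_space n) (Phi n J K)"
    by (rule invariance_of_domain_Euclidean_space_embedding_map[OF openin_Yset continuous_map_Phi inj_on_Phi])
  moreover have "topspace (subtopology (Euclidean_space n) (Yset n J K)) = Yset n J K"
    using Yset_subset by auto
  ultimately show ?thesis unfolding embedding_map_def by (simp add: Phi_surj)
qed

lemma locally_bilipschitz_Phi: "locally_bilipschitz_on n (Yset n J K) (Phi n J K)"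
  unfolding locally_bilipschitz_on_def
proof
  fix y assume y: "y \<in> Yset n J K"
  obtain r L B where r: "0 < r" "0 \<le> L"
    "\<And>a. \<lbrakk>\<And>i. n \<le> i \<Longrightarrow> a i = 0; \<And>i. i < n \<Longrightarrow> \<bar>a i - y i\<bar> < r\<rbrakk> \<Longrightarrow> a \<in> Yset n J K \<and> (\<forall>j\<le>n. B \<le> m a j)"
    "\<And>a b i. \<lbrakk>a \<in> Yset n J K; b \<in> Yset n J K; \<And>i. i < n \<Longrightarrow> \<bar>a i - y i\<bar> < r; \<And>i. i < n \<Longrightarrow> \<bar>b i - y i\<bar> < r\<rbrakk>
      \<Longrightarrow> \<bar>Phi n J K a i - Phi n J K b i\<bar> \<le> L * (\<Sum>i<n. \<bar>a i - b i\<bar>)"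
    using Phi_locally_lipschitz[OF y] by blast
  obtain c where c: "0 < c"
    "\<And>y y'. \<lbrakk>y \<in> Yset n J K; y' \<in> Yset n J K; \<And>j. j \<le> n \<Longrightarrow> B \<le> m y j \<and> B \<le> m y' j\<rbrakk>
       \<Longrightarrow> c * (\<Sum>i<n. \<bar>y' i - y i\<bar>) \<le> (\<Sum>i<n. \<bar>Phi n J K y' i - Phi n J K y i\<bar>)"
    using Phi_expansive[of B] by blast
  \<comment> \<open>The factors come from comparing the sum norm with the Euclidean norm;
    \<open>Suc n\<close> keeps the lower constant positive for \<open>n = 0\<close>.\<close>
  have "c / real (Suc n) * edist n a b \<le> edist n (Phi n J K a) (Phi n J K b) \<and>
      edist n (Phi n J K a) (Phi n J K b) \<le> (real n * (L * real n)) * edist n a b"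
    if ab: "a \<in> Yset n J K" "b \<in> Yset n J K" "edist n a y < r" "edist n b y < r" for a b
  proof
    have ar: "\<And>i. i < n \<Longrightarrow> \<bar>a i - y i\<bar> < r" and br: "\<And>i. i < n \<Longrightarrow> \<bar>b i - y i\<bar> < r"
      using coordinate_le_edist ab(3,4) by (metis order_le_less_trans)+
    have "a i = 0" "b i = 0" if "n \<le> i" for i using ab that by (auto simp: Yset_def simplexS_def)
    then have B: "\<And>j. j \<le> n \<Longrightarrow> B \<le> m b j \<and> B \<le> m a j"
      using r(3)[of a] r(3)[of b] ar br by blast
    have nn: "0 \<le> edist n (Phi n J K a) (Phi n J K b)" by (simp add: edist_def L2_set_nonneg)
    have "c * edist n a b \<le> c * (\<Sum>i<n. \<bar>a i - b i\<bar>)"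
      using edist_le_L1 c(1) by (intro mult_left_mono) auto
    also have "\<dots> \<le> (\<Sum>i<n. \<bar>Phi n J K a i - Phi n J K b i\<bar>)" by (rule c(2)[OF ab(2,1) B])
    also have "\<dots> \<le> real n * edist n (Phi n J K a) (Phi n J K b)" by (rule L1_le_edist)
    also have "\<dots> \<le> real (Suc n) * edist n (Phi n J K a) (Phi n J K b)"
      using nn by (intro mult_right_mono) auto
    finally show "c / real (Suc n) * edist n a b \<le> edist n (Phi n J K a) (Phi n J K b)"
      by (simp add: pos_divide_le_eq mult.commute)
    have "edist n (Phi n J K a) (Phi n J K b) \<le> (\<Sum>i<n. \<bar>Phi n J K a i - Phi n J K b i\<bar>)" by (rule edist_le_L1)
    also have "\<dots> \<le> (\<Sum>i<n. L * (\<Sum>i<n. \<bar>a i - b i\<bar>))" by (intro sum_mono r(4)[OF ab(1,2) ar br])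
    also have "\<dots> = real n * (L * (\<Sum>i<n. \<bar>a i - b i\<bar>))" by simp
    also have "\<dots> \<le> real n * (L * (real n * edist n a b))"
      using L1_le_edist r(2) by (intro mult_left_mono) auto
    finally show "edist n (Phi n J K a) (Phi n J K b) \<le> (real n * (L * real n)) * edist n a b"
      by (simp add: mult.assoc)
  qed
  moreover have "0 < c / real (Suc n)" using c(1) by simp
  ultimately show "\<exists>r>0. \<exists>c>0. \<exists>C. \<forall>a\<in>Yset n J K. \<forall>b\<in>Yset n J K. edist n a y < r \<and> edist n b y < r \<longrightarrow>
      c * edist n a b \<le> edist n (Phi n J K a) (Phi n J K b) \<and> edist n (Phi n J K a) (Phi n J K b) \<le> C * edist n a b"
    using r(1) by blast
qed

end

theorem theorem7p1:
  fixes n :: nat and K :: "nat \<Rightarrow> real \<Rightarrow> real" and J :: "real \<Rightarrow> ereal"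
  assumes kern: "\<And>i. i < n \<Longrightarrow> kernel_function (K i) \<and> singular_kernel (K i) \<and>
                         strictly_concave_kernel (K i) \<and> PM 0 (K i)"
    and field: "field_function n J"
    and infty: "(J 0 = -\<infinity> \<and> (J \<longlongrightarrow> -\<infinity>) (at_right 0)) \<or>
                (J 1 = -\<infinity> \<and> (J \<longlongrightarrow> -\<infinity>) (at_left 1))"
  shows "homeomorphic_map (subtopology (Euclidean_space n) (Yset n J K)) (Euclidean_space n) (Phi n J K)
         \<and> locally_bilipschitz_on n (Yset n J K) (Phi n J K)"
proof -
  interpret translates n K J by unfold_locales (fact kern field infty)+
  show ?thesis using homeomorphic_map_Phi locally_bilipschitz_Phi ..
qed

end
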